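(* Let $f \colon \mathbb{C} \to \widehat{\mathbb{C}}$ be a meromorphic function and let $a, b \in \mathbb{C}$ be distinct complex numbers with $b \neq 0$. Suppose that $f'$ is bounded on $f^{-1}(a) = \{z \in \mathbb{C} : f(z) = a\}$ and that $f$ and $f'$ share the value $b$, i.e. for all $z \in \mathbb{C}$, $f(z) = b \Leftrightarrow f'(z) = b$. Then $f$ is normal.
   Context: $\widehat{\mathbb{C}} = \mathbb{C} \cup \{\infty\}$. A meromorphic function $f \colon \mathbb{C} \to \widehat{\mathbb{C}}$ is called normal if for every sequence $z_n \to \infty$ the family of functions $z \mapsto f(z_n + z)$ is a normal family on $\mathbb{C}$ (every sequence in it has a subsequence converging locally uniformly in the spherical metric to a meromorphic function or to the constant $\infty$). Equivalently, the spherical derivative $f^{\#}(z) = |f'(z)|/(1+|f(z)|^2)$ (extended continuously to the poles of $f$) is bounded on $\mathbb{C}$. *)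

theory Defs
  imports "HOL-Complex_Analysis.Complex_Analysis"
begin

datatype riemann_sphere = Finite complex | Infty

text \<open>
  A meromorphic function is represented by a complex-valued function that is
  \<open>nicely_meromorphic_on UNIV\<close>: it has no removable singularities, and its value at a pole
  is the dummy value 0. The corresponding map into the Riemann sphere sends the poles to
  infinity instead. The values of the derivative are those of \<open>to_sphere (deriv f)\<close>, since
  \<open>deriv f\<close> has the same poles as \<open>f\<close> (lemma \<open>is_pole_deriv_iff\<close>).
\<close>

definition to_sphere :: "(complex \<Rightarrow> complex) \<Rightarrow> complex \<Rightarrow> riemann_sphere" where
  "to_sphere f z = (if is_pole f z then Infty else Finite (f z))"

fun chordal_dist :: "riemann_sphere \<Rightarrow> riemann_sphere \<Rightarrow> real" where
  "chordal_dist (Finite z) (Finite w) =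
     norm (z - w) / (sqrt (1 + (norm z)\<^sup>2) * sqrt (1 + (norm w)\<^sup>2))"
| "chordal_dist (Finite z) Infty = 1 / sqrt (1 + (norm z)\<^sup>2)"
| "chordal_dist Infty (Finite w) = 1 / sqrt (1 + (norm w)\<^sup>2)"
| "chordal_dist Infty Infty = 0"

text \<open>
  On the sphere of diameter 1, a chord of length \<open>c\<close> subtends an arc of length \<open>arcsin c\<close>.
  Hence the following is the geodesic distance for the line element
  \<open>\<bar>dz\<bar> / (1 + \<bar>z\<bar>\<^sup>2)\<close>, the one that belongs to the
  spherical derivative \<open>\<bar>f'\<bar> / (1 + \<bar>f\<bar>\<^sup>2)\<close>.
\<close>

definition spherical_dist :: "riemann_sphere \<Rightarrow> riemann_sphere \<Rightarrow> real" where
  "spherical_dist p q = arcsin (chordal_dist p q)"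

definition spherically_loc_unif_conv ::
    "(nat \<Rightarrow> complex \<Rightarrow> riemann_sphere) \<Rightarrow> (complex \<Rightarrow> riemann_sphere) \<Rightarrow> bool" where
  "spherically_loc_unif_conv G g \<longleftrightarrow>
     (\<forall>z. \<exists>d>0. \<forall>e>0. \<forall>\<^sub>F n in sequentially.
        \<forall>w\<in>ball z d. spherical_dist (G n w) (g w) < e)"

definition normal_family :: "(complex \<Rightarrow> riemann_sphere) set \<Rightarrow> bool" where
  "normal_family \<F> \<longleftrightarrow>
     (\<forall>G :: nat \<Rightarrow> complex \<Rightarrow> riemann_sphere. (\<forall>n. G n \<in> \<F>) \<longrightarrow>
        (\<exists>r g. strict_mono r \<and> spherically_loc_unif_conv (G \<circ> r) g \<and>
           ((\<exists>h. h nicely_meromorphic_on UNIV \<and> g = to_sphere h) \<or> g = (\<lambda>_. Infty))))"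

definition normal_function :: "(complex \<Rightarrow> riemann_sphere) \<Rightarrow> bool" where
  "normal_function F \<longleftrightarrow>
     (\<forall>\<zeta> :: nat \<Rightarrow> complex. filterlim \<zeta> at_infinity sequentially \<longrightarrow>
        normal_family (range (\<lambda>n z. F (\<zeta> n + z))))"

end

theory Submission
  imports Defs "HOL-Library.Diagonal_Subsequence" "HOL-Real_Asymp.Real_Asymp"
begin

text \<open>
  Put \<open>F = f - a\<close>. If the spherical derivative of \<open>F\<close> is unbounded, the Zalcman-Pang rescaling
  \<open>g\<^sub>n(z) = F(p\<^sub>n + \<rho>\<^sub>n z) / \<rho>\<^sub>n\<close>, \<open>\<rho>\<^sub>n \<longlonglongrightarrow> 0\<close>, has a non-constant limit \<open>g\<close> of bounded spherical
  derivative. Here \<open>f = b\<close> means \<open>g\<^sub>n = (b - a) / \<rho>\<^sub>n\<close>, which tends to infinity, and \<open>f' = b\<close> means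
  \<open>g\<^sub>n' = b\<close>.

  The limit has no poles: near a pole put \<open>k\<^sub>n = 1 / g\<^sub>n\<close>. Where \<open>k\<^sub>n\<close> equals \<open>\<delta>\<^sub>n = \<rho>\<^sub>n / (b - a)\<close>, it does so
  simply and \<open>k\<^sub>n' + b k\<^sub>n\<^sup>2 = 0\<close>. By the maximum principle \<open>(k\<^sub>n' + b k\<^sub>n\<^sup>2) / (k\<^sub>n - \<delta>\<^sub>n)\<close> is bounded
  uniformly in \<open>n\<close>, so \<open>\<bar>k'\<bar> \<le> M \<bar>k\<bar>\<close> for the limit \<open>k\<close> and \<open>k\<close> cannot have an isolated zero.

  So \<open>g\<close> is entire, and by Hurwitz's theorem \<open>g'\<close> omits \<open>b\<close>. An entire function of bounded spherical
  derivative has exponential type, whence \<open>g' = b + exp (c z + d)\<close>. If \<open>c \<noteq> 0\<close>, the spherical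
  derivative of \<open>g\<close> is unbounded. So \<open>g\<close> is affine, and the bound on its slope at its zero contradicts
  the normalization of \<open>g'(0)\<close> in the rescaling.
\<close>

text \<open>The exponent 1 of \<open>\<rho>\<^sub>n\<close> is dictated by the hypotheses: it leaves
  derivatives unchanged, so that \<open>f' = b\<close> and the bound on \<open>f'\<close> at the
  a-points keep their form. The price is that the extremal choice behind the rescaling needs the
  derivative of \<open>F\<close> bounded at the zeros of \<open>F\<close>. So the bound on the
  preimage of \<open>a\<close> enters twice, once to rescale and once to exclude an affine limit.
  The obstacle is the poles of the limit. As \<open>b - a\<close> is not 0, the shared value of
  \<open>g\<^sub>n\<close> drifts to infinity: it is out of reach where the limit is finite, but
  near a pole it is taken, and there the sharing has to be used quantitatively. Hurwitz's theorem
  alone allows \<open>g' = b\<close> identically. To exclude this as well, one constant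
  \<open>A\<close> dominates both the derivatives at the zeros and \<open>norm b\<close>, and the
  rescaling is normalized so that the limit satisfies
  \<open>norm (g' 0) \<ge> A + 1\<close>.\<close>

section \<open>Schwarz, Harnack and Liouville estimates from a one-sided bound on the real
  part\<close>

text \<open>The Cayley map \<open>(u - h z) / (u + cnj (h z))\<close> sends the right half-plane to
  the unit disc and \<open>h z\<close> to 0, so Schwarz's lemma applies to \<open>\<phi>\<close>.
  Harnack's inequality and a Borel-Caratheodory estimate are both read off from this form.\<close>

lemma half_plane_schwarz:
  assumes hol: "h holomorphic_on ball z R" and pos: "\<And>w. w \<in> ball z R \<Longrightarrow> Re (h w) > 0"
    and w: "w \<in> ball z R"
  shows "norm (h w - h z) * R \<le> norm (h w + cnj (h z)) * dist z w"
proof -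
  have R: "R > 0" using w by (smt (verit) mem_ball zero_le_dist)
  have z: "z \<in> ball z R" using R by simp
  have nz: "h u + cnj (h z) \<noteq> 0" if "u \<in> ball z R" for u
    using pos[OF that] pos[OF z] by (auto simp: complex_eq_iff)
  define \<phi> where "\<phi> = (\<lambda>u. (h (z + of_real R * u) - h z) / (h (z + of_real R * u) + cnj (h z)))"
  have in_ball: "z + of_real R * u \<in> ball z R" if "norm u < 1" for u
    using that R by (simp add: dist_norm norm_mult)
  have "(h \<circ> (\<lambda>u. z + of_real R * u)) holomorphic_on ball 0 1"
    by (rule holomorphic_on_compose_gen[OF _ hol]) (use in_ball in \<open>auto intro!: holomorphic_intros\<close>)
  then have hh: "(\<lambda>u. h (z + of_real R * u)) holomorphic_on ball 0 1" by (simp add: o_def)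
  have hol\<phi>: "\<phi> holomorphic_on ball 0 1"
    unfolding \<phi>_def by (intro holomorphic_intros hh) (use nz in_ball in auto)
  have lt: "norm (\<phi> u) < 1" if "norm u < 1" for u
  proof -
    define p where "p = h (z + of_real R * u)"
    have p: "Re p > 0" using pos[OF in_ball[OF that]] by (simp add: p_def)
    have q: "Re (h z) > 0" using pos[OF z] .
    \<comment> \<open>The two sides differ by \<open>4 * Re p * Re (h z)\<close>.\<close>
    have "(norm (p - h z))\<^sup>2 < (norm (p + cnj (h z)))\<^sup>2"
      using mult_pos_pos[OF p q] unfolding cmod_power2 by (simp add: power2_eq_square algebra_simps)
    then have "norm (p - h z) < norm (p + cnj (h z))"
      by (meson norm_ge_zero power2_less_imp_less)
    then show ?thesis
      by (simp add: \<phi>_def p_def[symmetric] norm_divide) (smt (verit) divide_less_eq_1 norm_ge_zero)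
  qed
  define u where "u = (w - z) / of_real R"
  have u: "norm u < 1" using w R by (simp add: u_def norm_divide dist_norm norm_minus_commute)
  have zu: "z + of_real R * u = w" using R by (simp add: u_def)
  have "norm (\<phi> u) \<le> norm u"
    by (rule Schwarz_Lemma(1)[OF hol\<phi> _ lt u]) (simp_all add: \<phi>_def)
  moreover have "norm u = dist z w / R" using R by (simp add: u_def norm_divide dist_norm norm_minus_commute)
  ultimately have "norm (h w - h z) / norm (h w + cnj (h z)) \<le> dist z w / R"
    by (simp add: \<phi>_def zu norm_divide)
  then show ?thesis using R nz[OF w] by (simp add: field_simps)
qed

lemma Harnack_lower:
  assumes hol: "h holomorphic_on ball z R" and pos: "\<And>w. w \<in> ball z R \<Longrightarrow> Re (h w) > 0"
    and w: "w \<in> ball z R"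
  shows "Re (h z) * (R - dist z w) \<le> Re (h w) * (R + dist z w)"
proof -
  have z: "z \<in> ball z R" using w by (smt (verit) mem_ball zero_le_dist dist_self)
  define x y v where "x = Re (h z)" and "y = Re (h w)" and "v = Im (h w) - Im (h z)"
  define d where "d = dist z w"
  have d: "0 \<le> d" "d < R" using w by (auto simp: d_def)
  then have R: "0 < R" by linarith
  have xy: "0 < x" "0 < y" using pos z w by (auto simp: x_def y_def)
  have "(norm (h w - h z) * R)\<^sup>2 \<le> (norm (h w + cnj (h z)) * d)\<^sup>2"
    using half_plane_schwarz[OF assms] R by (intro power_mono) (auto simp: d_def)
  then have "((y - x)\<^sup>2 + v\<^sup>2) * R\<^sup>2 \<le> ((y + x)\<^sup>2 + v\<^sup>2) * d\<^sup>2"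
    by (simp add: power_mult_distrib cmod_power2 x_def y_def v_def)
  moreover have "v\<^sup>2 * d\<^sup>2 \<le> v\<^sup>2 * R\<^sup>2" using d by (intro mult_left_mono power_mono) auto
  ultimately have "((y - x) * R)\<^sup>2 \<le> ((y + x) * d)\<^sup>2"
    unfolding power_mult_distrib by (simp add: algebra_simps)
  then have "\<bar>(y - x) * R\<bar> \<le> \<bar>(y + x) * d\<bar>" by (simp add: abs_le_square_iff)
  moreover have "\<bar>(y + x) * d\<bar> = (y + x) * d" using xy d by simp
  ultimately have "(x - y) * R \<le> (y + x) * d" by (smt (verit) minus_mult_left)
  then show ?thesis by (simp add: algebra_simps x_def y_def d_def)
qed

text \<open>A Borel-Caratheodory argument: on the disc of radius \<open>2 * norm w\<close> the
  function \<open>B - v\<close> has positive real part, and \<open>half_plane_schwarz\<close> turns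
  the one-sided bound into \<open>norm (v w) \<le> 2 * B\<close>, which is linear in
  \<open>norm w\<close>. Liouville's theorem for polynomial growth leaves degree at most 1.\<close>

lemma entire_affine_if_Re_le:
  assumes hol: "u holomorphic_on UNIV" and le: "\<And>z. Re (u z) \<le> C * (1 + norm z)"
  obtains c d where "\<And>z. u z = c * z + d"
proof -
  define v where "v = (\<lambda>z. u z - u 0)"
  \<comment> \<open>\<open>\<bar>Re (u 0)\<bar>\<close> pays for subtracting \<open>u 0\<close>; the
    1 makes the bound on \<open>Re v\<close> strict, as the positivity of \<open>Re (B - v)\<close>
    requires.\<close>
  define C' where "C' = \<bar>C\<bar> + \<bar>Re (u 0)\<bar> + 1"
  have C': "C' > 0" "C' \<ge> C" by (auto simp: C'_def)
  have holv: "v holomorphic_on UNIV" unfolding v_def by (intro holomorphic_intros hol)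
  have v0: "v 0 = 0" by (simp add: v_def)
  have Rev: "Re (v z) < C' * (1 + norm z)" for z
  proof -
    have "Re (v z) \<le> C * (1 + norm z) + \<bar>Re (u 0)\<bar>" using le[of z] by (simp add: v_def)
    also have "\<dots> \<le> \<bar>C\<bar> * (1 + norm z) + \<bar>Re (u 0)\<bar> * (1 + norm z)"
      by (intro add_mono mult_right_mono) (auto simp: algebra_simps)
    also have "\<dots> < C' * (1 + norm z)" by (simp add: C'_def algebra_simps add_pos_nonneg)
    finally show ?thesis .
  qed
  have bound: "norm (v w) \<le> 6 * C' * norm w ^ 1" if w: "1 \<le> norm w" for w
  proof -
    define R where "R = 2 * norm w"
    define B where "B = C' * (1 + R)"
    have B: "B > 0" using C' by (auto simp: B_def R_def intro!: mult_pos_pos add_pos_nonneg)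
    define h where "h = (\<lambda>z. of_real B - v z)"
    have "norm (h w - h 0) * R \<le> norm (h w + cnj (h 0)) * dist 0 w"
    proof (rule half_plane_schwarz)
      show "h holomorphic_on ball 0 R" unfolding h_def
        by (intro holomorphic_intros holomorphic_on_subset[OF holv]) auto
      show "w \<in> ball 0 R" using w by (simp add: R_def) auto
      fix z :: complex assume "z \<in> ball 0 R"
      then have "C' * (1 + norm z) \<le> B" unfolding B_def using C' by (intro mult_left_mono) auto
      then show "Re (h z) > 0" using Rev[of z] by (simp add: h_def)
    qed
    then have "norm (v w) * 2 * norm w \<le> norm (2 * of_real B - v w) * norm w"
      by (simp add: h_def v0 R_def mult_ac)
    moreover have "norm w > 0" using w by linarith
    ultimately have "norm (v w) * 2 \<le> norm (2 * of_real B - v w)"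
      by (rule mult_right_le_imp_le)
    also have "\<dots> \<le> 2 * B + norm (v w)"
      using norm_triangle_ineq4[of "2 * of_real B" "v w"] B by (simp add: norm_mult)
    finally have "norm (v w) \<le> 2 * B" by simp
    also have "B \<le> C' * (3 * norm w)" unfolding B_def R_def using C' w by (intro mult_left_mono) auto
    finally show ?thesis by simp
  qed
  have "v z = (\<Sum>k\<le>1. (deriv ^^ k) v 0 / fact k * z ^ k)" for z
    by (rule Liouville_polynomial[OF holv, of 1 "6 * C'"]) (rule bound)
  moreover have "(\<Sum>k\<le>1. (deriv ^^ k) v 0 / fact k * z ^ k) = deriv v 0 * z" for z
    using v0 by simp
  ultimately have "v z = deriv v 0 * z" for z by (rule trans)
  then have "u z = deriv v 0 * z + u 0" for z by (metis diff_add_cancel v_def)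
  then show ?thesis using that by blast
qed

lemma Cauchy_deriv_bound:
  assumes "f holomorphic_on ball z R" "0 < r" "r < R"
    and "\<And>w. norm (w - z) = r \<Longrightarrow> norm (f w) \<le> B"
  shows "norm (deriv f z) \<le> B / r"
proof -
  have "norm ((deriv ^^ 1) f z) \<le> fact 1 * B / r ^ 1"
  proof (rule Cauchy_inequality)
    show "f holomorphic_on ball z r" using assms by (auto intro: holomorphic_on_subset)
    show "continuous_on (cball z r) f"
      using assms by (intro holomorphic_on_imp_continuous_on holomorphic_on_subset[OF assms(1)]) auto
  qed (use assms in \<open>auto simp: norm_minus_commute\<close>)
  then show ?thesis by simp
qed

text \<open>At a point nearest to @ the set \<open>\<bar>g\<bar> \<le> 1\<close> the positive harmonic function \<open>ln \<bar>g\<bar>\<close>\<close>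

section \<open>Entire functions of bounded spherical derivative\<close>

text \<open>
  Compare the positive harmonic function \<open>ln \<bar>g\<bar>\<close> on the largest disc around \<open>z\<close> in \<open>{\<bar>g\<bar> > 1}\<close> with its
  normal derivative at a boundary point \<open>q\<close> where \<open>\<bar>g q\<bar> = 1\<close>; there the spherical derivative controls it.
\<close>

lemma growth_of_bounded_spherical_deriv:
  assumes hol: "g holomorphic_on UNIV" and bd: "\<And>z. norm (deriv g z) \<le> M * (1 + (norm (g z))\<^sup>2)"
    and p: "norm (g p) \<le> 1"
  shows "norm (g z) \<le> exp (4 * M * dist z p)"
proof -
  define E where "E = {w. norm (g w) \<le> 1}"
  have contg: "continuous_on UNIV g" using hol by (rule holomorphic_on_imp_continuous_on)
  have M: "M \<ge> 0"
    using bd[of 0] norm_ge_zero[of "deriv g 0"] by (smt (verit) mult_neg_pos zero_le_power2)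
  show ?thesis
  proof (cases "z \<in> E")
    case True
    then show ?thesis using M by (auto simp: E_def intro: order_trans)
  next
    case False
    have "closed E" unfolding E_def
      by (intro closed_Collect_le continuous_intros contg)
    moreover have "E \<noteq> {}" using p by (auto simp: E_def)
    ultimately obtain q where q: "q \<in> E" "\<And>y. y \<in> E \<Longrightarrow> dist z q \<le> dist z y"
      by (rule distance_attains_inf[of E z]) blast
    define R where "R = dist z q"
    have R: "R > 0" using False q by (auto simp: R_def)
    have big: "norm (g w) > 1" if "w \<in> ball z R" for w
      using q(2)[of w] that by (force simp: E_def R_def)
    have gh: "g holomorphic_on ball z R" using hol by (rule holomorphic_on_subset) auto
    have nz: "g w \<noteq> 0" if "w \<in> ball z R" for w using big[OF that] by auto
    obtain h where h: "h holomorphic_on ball z R" and geq: "\<And>w. w \<in> ball z R \<Longrightarrow> g w = exp (h w)"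
      using contractible_imp_holomorphic_log[OF gh _ nz] convex_imp_contractible[OF convex_ball] by blast
    have Re_h: "Re (h w) = ln (norm (g w))" if "w \<in> ball z R" for w
      using geq[OF that] by simp
    have pos: "Re (h w) > 0" if "w \<in> ball z R" for w
      using big[OF that] Re_h[OF that] by (simp add: ln_gt_zero)
    define \<gamma> where "\<gamma> = (\<lambda>s. z + of_real s * (q - z))"
    have q1: "norm (g q) \<le> 1" using q(1) by (simp add: E_def)
    have est: "Re (h z) \<le> 2 * R * norm ((g (\<gamma> s) - g q) / (\<gamma> s - q))" if s: "0 < s" "s < 1" for s
    proof -
      have d: "dist z (\<gamma> s) = s * R"
        using s by (simp add: \<gamma>_def dist_norm norm_mult R_def norm_minus_commute)
      have in_b: "\<gamma> s \<in> ball z R" using d s R by simp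
      have "\<gamma> s - q = of_real (s - 1) * (q - z)" by (simp add: \<gamma>_def algebra_simps)
      then have d2: "norm (\<gamma> s - q) = (1 - s) * R"
        using s by (simp add: norm_mult R_def dist_norm norm_minus_commute del: of_real_diff)
      \<comment> \<open>Harnack's lower bound vanishes only linearly as \<open>\<gamma> s\<close>
        approaches \<open>q\<close>, so it survives division by \<open>norm (\<gamma> s - q)\<close>
        and becomes a bound by \<open>deriv g q\<close>.\<close>
      have "Re (h z) * (R - s * R) \<le> Re (h (\<gamma> s)) * (R + s * R)"
        using Harnack_lower[OF h pos in_b] d by simp
      also have "\<dots> \<le> Re (h (\<gamma> s)) * (2 * R)"
        using pos[OF in_b] s R by (intro mult_left_mono) auto
      \<comment> \<open>\<open>ln x \<le> x - 1\<close> and \<open>norm (g q) \<le> 1\<close>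
        replace the logarithm by an increment of \<open>g\<close> at \<open>q\<close>.\<close>
      also have "Re (h (\<gamma> s)) \<le> norm (g (\<gamma> s)) - 1"
        using Re_h[OF in_b] big[OF in_b] ln_le_minus_one[of "norm (g (\<gamma> s))"] by linarith
      also have "\<dots> \<le> norm (g (\<gamma> s) - g q)"
        using q1 norm_triangle_ineq2[of "g (\<gamma> s)" "g q"] by linarith
      finally have "Re (h z) * ((1 - s) * R) \<le> 2 * R * norm (g (\<gamma> s) - g q)"
        using R by (simp add: algebra_simps)
      then have "Re (h z) * norm (\<gamma> s - q) \<le> 2 * R * norm (g (\<gamma> s) - g q)" by (simp only: d2)
      moreover have "norm (\<gamma> s - q) > 0" using d2 s R by simp
      ultimately show ?thesis by (simp add: norm_divide pos_le_divide_eq)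
    qed
    have "(g has_field_derivative deriv g q) (at q)"
      using hol by (simp add: holomorphic_derivI)
    then have "((\<lambda>y. (g y - g q) / (y - q)) \<longlongrightarrow> deriv g q) (at q)"
      by (simp add: has_field_derivative_iff)
    moreover have "filterlim \<gamma> (at q) (at_left 1)"
      unfolding filterlim_at
    proof
      have "(\<gamma> \<longlongrightarrow> \<gamma> 1) (at_left 1)" unfolding \<gamma>_def by (intro tendsto_intros)
      then show "(\<gamma> \<longlongrightarrow> q) (at_left 1)" by (simp add: \<gamma>_def)
      have "\<gamma> s \<noteq> q" if "s < 1" for s
      proof
        assume "\<gamma> s = q"
        then have "of_real (s - 1) * (q - z) = 0" by (simp add: \<gamma>_def algebra_simps)
        then show False using that R by (simp add: R_def)
      qed
      then show "\<forall>\<^sub>F s in at_left 1. \<gamma> s \<in> UNIV \<and> \<gamma> s \<noteq> q"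
        by (auto simp: eventually_at_filter)
    qed
    ultimately have "((\<lambda>s. (g (\<gamma> s) - g q) / (\<gamma> s - q)) \<longlongrightarrow> deriv g q) (at_left 1)"
      by (rule filterlim_compose)
    then have lim: "((\<lambda>s. 2 * R * norm ((g (\<gamma> s) - g q) / (\<gamma> s - q))) \<longlongrightarrow> 2 * R * norm (deriv g q)) (at_left 1)"
      by (intro tendsto_intros)
    have "\<forall>\<^sub>F s in at_left (1::real). 0 < s \<and> s < 1"
      using eventually_at_left_real[of 0 1] by (auto elim: eventually_mono)
    then have "\<forall>\<^sub>F s in at_left 1. Re (h z) \<le> 2 * R * norm ((g (\<gamma> s) - g q) / (\<gamma> s - q))"
      by eventually_elim (use est in auto)
    then have "Re (h z) \<le> 2 * R * norm (deriv g q)"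
      by (intro tendsto_lowerbound[OF lim]) auto
    also have "\<dots> \<le> 2 * R * (M * 2)"
    proof -
      have "(norm (g q))\<^sup>2 \<le> 1" using q1 by (simp add: power_le_one)
      then have "M * (1 + (norm (g q))\<^sup>2) \<le> M * 2" using M by (intro mult_left_mono) auto
      then show ?thesis using bd[of q] R by (intro mult_left_mono) auto
    qed
    also have "\<dots> \<le> 4 * M * dist z p"
      using q(2)[of p] p M by (simp add: E_def R_def mult_left_mono mult_ac)
    finally have "exp (Re (h z)) \<le> exp (4 * M * dist z p)" by simp
    then show ?thesis using geq[of z] R by simp
  qed
qed

text \<open>
  The witnesses are approximate zeros: for \<open>W = Ln x + 2 \<pi> n \<i>\<close> with \<open>x = - 2 \<pi> n \<i> b\<close> and \<open>c z + d = W\<close>, the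
  terms of order \<open>n\<close> in \<open>b z + exp W / c\<close> cancel and only \<open>O(ln n)\<close> remains, while the derivative is of order \<open>n\<close>.
\<close>

lemma exp_plus_linear_unbounded_spherical_deriv:
  fixes b c d K :: complex
  assumes "b \<noteq> 0" "c \<noteq> 0"
  shows "\<exists>z. norm (b + exp (c * z + d)) > M * (1 + (norm (b * z + exp (c * z + d) / c + K))\<^sup>2)"
proof (rule ccontr)
  assume "\<not> ?thesis"
  then have H: "norm (b + exp (c * z + d)) \<le> M * (1 + (norm (b * z + exp (c * z + d) / c + K))\<^sup>2)" for z
    by (simp add: not_less)
  define \<alpha> where "\<alpha> = norm (b / c)"
  \<comment> \<open>Collects what stays bounded in \<open>b / c * (Ln x - d) + K\<close>: the
    argument of \<open>x\<close> is at most \<open>pi\<close> in absolute value, and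
    \<open>norm x\<close> is \<open>2 * pi * norm b * n\<close>.\<close>
  define \<beta> where "\<beta> = \<alpha> * (\<bar>ln (2 * pi * norm b)\<bar> + pi + norm d) + norm K"
  have M: "M \<ge> 0" using H[of 0] norm_ge_zero[of "b + exp (c * 0 + d)"]
    by (smt (verit) mult_neg_pos zero_le_power2)
  have key: "norm b * real n \<le> M * (1 + (\<alpha> * ln (real n) + \<beta>)\<^sup>2)" if n: "n \<ge> 1" for n :: nat
  proof -
    define x where "x = - (2 * of_real pi * of_nat n * \<i> * b)"
    have x0: "x \<noteq> 0" using n assms by (simp add: x_def)
    define W where "W = Ln x + 2 * of_real pi * of_nat n * \<i>"
    have expW: "exp W = x"
    proof -
      have "exp (2 * of_real pi * of_nat n * \<i>) = (1::complex)"
        using exp_integer_2pi[of "of_nat n"] by (simp add: mult_ac)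
      then show ?thesis using x0 by (simp add: W_def exp_add)
    qed
    define z where "z = (W - d) / c"
    have cz: "c * z + d = W" using assms by (simp add: z_def)
    have "b * z + exp W / c + K = b / c * (Ln x - d) + K"
      unfolding expW unfolding z_def W_def x_def using assms by (simp add: field_simps)
    also have "norm \<dots> \<le> \<alpha> * norm (Ln x - d) + norm K"
      by (metis norm_mult norm_triangle_ineq \<alpha>_def)
    also have "\<dots> \<le> \<alpha> * ln (real n) + \<beta>"
    proof -
      have "norm (Ln x) \<le> \<bar>Re (Ln x)\<bar> + \<bar>Im (Ln x)\<bar>" by (rule cmod_le)
      moreover have "\<bar>Im (Ln x)\<bar> \<le> pi" using Im_Ln_le_pi[OF x0] mpi_less_Im_Ln[OF x0] by linarith
      moreover have "norm x = (2 * pi * norm b) * real n" by (simp add: x_def norm_mult)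
      then have "Re (Ln x) = ln (2 * pi * norm b) + ln (real n)"
        using x0 n assms by (simp add: ln_mult)
      then have "\<bar>Re (Ln x)\<bar> \<le> \<bar>ln (2 * pi * norm b)\<bar> + ln (real n)"
        using n ln_ge_zero[of "real n"] by linarith
      ultimately have "norm (Ln x - d) \<le> ln (real n) + (\<bar>ln (2 * pi * norm b)\<bar> + pi + norm d)"
        using norm_triangle_ineq4[of "Ln x" d] by linarith
      then have "\<alpha> * norm (Ln x - d) \<le> \<alpha> * (ln (real n) + (\<bar>ln (2 * pi * norm b)\<bar> + pi + norm d))"
        by (intro mult_left_mono) (auto simp: \<alpha>_def)
      then show ?thesis by (simp add: \<beta>_def algebra_simps)
    qed
    finally have "(norm (b * z + exp W / c + K))\<^sup>2 \<le> (\<alpha> * ln (real n) + \<beta>)\<^sup>2"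
      by (intro power_mono) auto
    then have "norm (b + x) \<le> M * (1 + (\<alpha> * ln (real n) + \<beta>)\<^sup>2)"
      using H[of z] M unfolding cz expW by (smt (verit) mult_left_mono)
    moreover have "norm (b + x) \<ge> norm b * real n"
    proof -
      have "b + x = b * Complex 1 (- (2 * pi * real n))"
        by (simp add: x_def complex_eq_iff algebra_simps)
      moreover have "norm (Complex 1 (- (2 * pi * real n))) \<ge> \<bar>Im (Complex 1 (- (2 * pi * real n)))\<bar>"
        by (rule abs_Im_le_cmod)
      moreover have "real n \<le> 2 * pi * real n" using pi_gt3 by (simp add: mult_le_cancel_right1)
      ultimately show ?thesis by (simp add: norm_mult mult_left_mono)
    qed
    ultimately show ?thesis by linarith
  qed
  \<comment> \<open>Divide \<open>key\<close> by n: the left side is the positive constant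
    \<open>norm b\<close>, while the right side tends to 0 because a squared logarithm is
    o(n).\<close>
  have "(\<lambda>n. 1 / real n) \<longlonglongrightarrow> 0" "(\<lambda>n. ln (real n) / real n) \<longlonglongrightarrow> 0"
    "(\<lambda>n. (ln (real n))\<^sup>2 / real n) \<longlonglongrightarrow> 0"
    by real_asymp+
  then have "(\<lambda>n. M * (1 + \<beta>\<^sup>2) * (1 / real n) + 2 * M * \<alpha> * \<beta> * (ln (real n) / real n) +
      M * \<alpha>\<^sup>2 * ((ln (real n))\<^sup>2 / real n)) \<longlonglongrightarrow>
      M * (1 + \<beta>\<^sup>2) * 0 + 2 * M * \<alpha> * \<beta> * 0 + M * \<alpha>\<^sup>2 * 0"
    by (intro tendsto_add tendsto_mult_left)
  also have "(\<lambda>n. M * (1 + \<beta>\<^sup>2) * (1 / real n) + 2 * M * \<alpha> * \<beta> * (ln (real n) / real n) +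
      M * \<alpha>\<^sup>2 * ((ln (real n))\<^sup>2 / real n)) =
      (\<lambda>n. M * (1 + (\<alpha> * ln (real n) + \<beta>)\<^sup>2) / real n)"
    by (rule ext) (simp add: add_divide_distrib[symmetric] power2_eq_square algebra_simps)
  finally have "(\<lambda>n. M * (1 + (\<alpha> * ln (real n) + \<beta>)\<^sup>2) / real n) \<longlonglongrightarrow> 0" by simp
  then have "\<forall>\<^sub>F n in at_top. M * (1 + (\<alpha> * ln (real n) + \<beta>)\<^sup>2) / real n < norm b"
    using assms by (intro order_tendstoD) auto
  then have "\<forall>\<^sub>F n :: nat in at_top. False"
    using eventually_ge_at_top[of 1]
  proof eventually_elim
    case (elim n)
    then show False using key[of n] by (simp add: field_simps)
  qed
  then show False by simp
qed

lemma entire_bounded_spherical_deriv_omit: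
  assumes hol: "g holomorphic_on UNIV" and bd: "\<And>z. norm (deriv g z) \<le> M * (1 + (norm (g z))\<^sup>2)"
    and b: "b \<noteq> 0" and omit: "\<And>z. deriv g z \<noteq> b"
  obtains s where "\<And>z. deriv g z = s"
proof (cases "\<exists>p. norm (g p) \<le> 1")
  \<comment> \<open>The growth estimate needs a base point where \<open>norm g \<le> 1\<close>.
    Without one, \<open>1 / g\<close> is bounded and \<open>g\<close> is constant.\<close>
  case False
  then have big: "norm (g z) > 1" for z by (simp add: not_le)
  have nz: "g z \<noteq> 0" for z using big[of z] by auto
  have "(\<lambda>z. inverse (g z)) holomorphic_on UNIV" by (intro holomorphic_intros hol) (use nz in auto)
  moreover have "bounded (range (\<lambda>z. inverse (g z)))"
    by (rule boundedI[of _ 1]) (use less_imp_le[OF big] in \<open>auto simp: norm_inverse inverse_le_1_iff\<close>)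
  ultimately obtain k where "\<And>z. inverse (g z) = k"
    using Liouville_theorem unfolding constant_on_def by blast
  then have "g = (\<lambda>_. inverse k)" by (metis inverse_inverse_eq)
  then have "deriv g z = 0" for z by simp
  then show ?thesis using that by blast
next
  case True
  then obtain p where p: "norm (g p) \<le> 1" by blast
  have M: "M \<ge> 0"
    using bd[of 0] norm_ge_zero[of "deriv g 0"] by (smt (verit) mult_neg_pos zero_le_power2)
  have growth: "norm (g z) \<le> exp (4 * M * (norm z + norm p))" for z
  proof -
    have "norm (g z) \<le> exp (4 * M * dist z p)" by (rule growth_of_bounded_spherical_deriv[OF hol bd p])
    also have "\<dots> \<le> exp (4 * M * (norm z + norm p))"
      using M by (auto simp: dist_norm intro!: mult_left_mono norm_triangle_ineq4)
    finally show ?thesis .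
  qed
  \<comment> \<open>Chosen so that \<open>X + norm b \<le> C * (1 + norm z)\<close>, where
    \<open>exp X\<close> bounds \<open>g\<close> on the unit circle around \<open>z\<close>.\<close>
  define C where "C = 4 * M * (1 + norm p) + norm b"
  have hold: "(\<lambda>z. deriv g z - b) holomorphic_on UNIV"
    by (intro holomorphic_intros holomorphic_deriv hol) auto
  obtain u where u: "u holomorphic_on UNIV" and ueq: "\<And>z. deriv g z - b = exp (u z)"
    using contractible_imp_holomorphic_log[OF hold contractible_UNIV] omit by auto
  have "Re (u z) \<le> C * (1 + norm z)" for z
  proof -
    define X where "X = 4 * M * (norm z + 1 + norm p)"
    have X: "X \<ge> 0" using M by (simp add: X_def)
    have "norm (deriv g z) \<le> exp X / 1"
    proof (rule Cauchy_deriv_bound[where R = 2])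
      fix w assume "norm (w - z) = 1"
      then have "norm w \<le> norm z + 1" by (metis norm_triangle_sub)
      then have "exp (4 * M * (norm w + norm p)) \<le> exp X"
        unfolding X_def using M by (auto intro!: mult_left_mono)
      then show "norm (g w) \<le> exp X" using growth[of w] by linarith
    qed (auto intro: holomorphic_on_subset[OF hol])
    then have "norm (deriv g z - b) \<le> exp X + norm b"
      using norm_triangle_ineq4[of "deriv g z" b] by simp
    \<comment> \<open>Since \<open>exp X \<ge> 1\<close>, the summand \<open>norm b\<close> is
      absorbed by a factor \<open>1 + norm b \<le> exp (norm b)\<close>, and the logarithm of the
      bound stays linear.\<close>
    also have "\<dots> \<le> exp X * (1 + norm b)" using X by (simp add: algebra_simps mult_le_cancel_left1)
    also have "\<dots> \<le> exp X * exp (norm b)" by (intro mult_left_mono) auto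
    finally have "exp (Re (u z)) \<le> exp (X + norm b)" by (simp add: ueq exp_add)
    then have "Re (u z) \<le> X + norm b" by simp
    also have "\<dots> \<le> C * (1 + norm z)" using M by (simp add: C_def X_def algebra_simps)
    finally show ?thesis .
  qed
  then obtain c d where cd: "\<And>z. u z = c * z + d" using entire_affine_if_Re_le[OF u] by blast
  have der: "deriv g z = b + exp (c * z + d)" for z using ueq[of z] cd[of z] by (simp add: algebra_simps)
  show ?thesis
  proof (cases "c = 0")
    case True
    then show ?thesis using der that by simp
  next
    case False
    have "((\<lambda>z. g z - (b * z + exp (c * z + d) / c)) has_field_derivative 0) (at z)" for z
    proof -
      have "(g has_field_derivative b + exp (c * z + d)) (at z)"
        using holomorphic_derivI[OF hol, of z] der[of z] by simp
      then show ?thesis using False by (auto intro!: derivative_eq_intros)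
    qed
    then obtain K where "\<And>z. g z - (b * z + exp (c * z + d) / c) = K"
      using has_field_derivative_zero_constant[of UNIV "\<lambda>z. g z - (b * z + exp (c * z + d) / c)"] by auto
    then have "g z = b * z + exp (c * z + d) / c + K" for z by (metis add.commute diff_add_cancel)
    then show ?thesis
      using exp_plus_linear_unbounded_spherical_deriv[OF b False, of M d K] bd der
      by (metis not_le)
  qed
qed

section \<open>Maximum principle for quotients, and a differential inequality at zeros\<close>

text \<open>The zeros of \<open>h\<close> are simple and are zeros of \<open>p\<close>, so
  \<open>p / h\<close> extends holomorphically and the maximum principle carries the bound inwards
  from the circle. In product form it makes sense at the zeros of \<open>h\<close> too.\<close>

lemma quotient_bound_on_disc:
  assumes h: "h holomorphic_on ball z R" and p: "p holomorphic_on ball z R" and r: "0 < r" "r < R"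
    and simple: "\<And>w. w \<in> ball z r \<Longrightarrow> h w = 0 \<Longrightarrow> p w = 0 \<and> deriv h w \<noteq> 0"
    and sph: "\<And>w. w \<in> sphere z r \<Longrightarrow> h w \<noteq> 0 \<and> norm (p w) \<le> M * norm (h w)"
    and w: "w \<in> ball z r"
  shows "norm (p w) \<le> M * norm (h w)"
proof -
  \<comment> \<open>At a zero of \<open>h\<close> the value is the limit of \<open>p / h\<close> by
    L'Hopital's rule; so \<open>q\<close> is continuous there, and the singularity is
    removable.\<close>
  define q where "q = (\<lambda>w. if h w = 0 then deriv p w / deriv h w else p w / h w)"
  have q_at: "\<exists>e>0. q holomorphic_on ball w e" if w: "w \<in> cball z r" for w
  proof -
    have wR: "w \<in> ball z R" using w r by auto
    have hw: "h analytic_on {w}" "isCont h w" 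
      using h wR analytic_at holomorphic_on_imp_analytic_at analytic_at_imp_isCont by blast+
    have ev0: "\<forall>\<^sub>F u in at w. h u \<noteq> 0"
    proof (cases "h w = 0")
      case False
      then show ?thesis using hw(2) by (metis isCont_def tendsto_imp_eventually_ne)
    next
      case True
      then have "w \<in> ball z r" using w sph by (metis mem_ball mem_cball mem_sphere order_le_less)
      then have "deriv h w \<noteq> 0" using simple True by blast
      then have "isolated_zero h w"
        using non_isolated_zero_imp_eventually_zero'[OF hw(1) True] deriv_cong_ev[of h "\<lambda>_. 0" w w] by auto
      then show ?thesis by (simp add: isolated_zero_def)
    qed
    then obtain e1 where e1: "e1 > 0" "\<And>u. u \<noteq> w \<Longrightarrow> dist u w < e1 \<Longrightarrow> h u \<noteq> 0"
      unfolding eventually_at by blast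
    obtain e2 where e2: "e2 > 0" "ball w e2 \<subseteq> ball z R" using wR open_contains_ball by blast
    define e where "e = min e1 e2"
    have e: "e > 0" "ball w e \<subseteq> ball z R" "\<And>u. u \<in> ball w e - {w} \<Longrightarrow> h u \<noteq> 0"
      using e1 e2 by (auto simp: e_def dist_commute)
    have hol_pq: "(\<lambda>u. p u / h u) holomorphic_on ball w e - {w}"
      by (intro holomorphic_intros holomorphic_on_subset[OF h] holomorphic_on_subset[OF p]) (use e in auto)
    have "(\<lambda>u. p u / h u) holomorphic_on ball w e - {w} \<longleftrightarrow> q holomorphic_on ball w e - {w}"
      by (rule holomorphic_cong) (use e in \<open>auto simp: q_def\<close>)
    with hol_pq have hol1: "q holomorphic_on ball w e - {w}" by simp
    have ev: "\<forall>\<^sub>F u in at w. p u / h u = q u" using ev0 by eventually_elim (simp add: q_def)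
    have "((\<lambda>u. p u / h u) \<longlongrightarrow> q w) (at w)"
    proof (cases "h w = 0")
      case False
      have "isCont p w"
        using p wR holomorphic_on_imp_analytic_at analytic_at_imp_isCont by blast
      then show ?thesis using hw(2) False by (auto simp: q_def isCont_def intro!: tendsto_intros)
    next
      case True
      then have "w \<in> ball z r" using w sph by (metis mem_ball mem_cball mem_sphere order_le_less)
      then have *: "p w = 0" "deriv h w \<noteq> 0" using simple True by blast+
      show ?thesis
        by (rule lhopital_complex_simple[where f' = "deriv p w" and g' = "deriv h w"])
           (use * True wR h p in \<open>auto simp: q_def intro!: holomorphic_derivI[of _ "ball z R"]\<close>)
    qed
    then have "(q \<longlongrightarrow> q w) (at w)" using ev by (simp add: tendsto_cong)
    then have "q holomorphic_on ball w e"
      by (intro no_isolated_singularity'[where K = "{w}", OF _ hol1])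
        (auto intro: tendsto_within_subset)
    then show ?thesis using e by blast
  qed
  have "q analytic_on cball z r" unfolding analytic_on_def using q_at by blast
  then have hq: "q holomorphic_on cball z r" by (rule analytic_imp_holomorphic)
  have "norm (q w) \<le> M"
  proof (rule maximum_modulus_frontier[where S = "cball z r" and f = q])
    show "q holomorphic_on interior (cball z r)" using hq by (rule holomorphic_on_subset) (rule interior_subset)
    show "continuous_on (closure (cball z r)) q" using hq by (simp add: holomorphic_on_imp_continuous_on)
    fix u assume "u \<in> frontier (cball z r)"
    then have "u \<in> sphere z r" using r by (simp add: frontier_cball)
    then show "norm (q u) \<le> M" using sph[of u] by (simp add: q_def norm_divide field_simps)
  qed (use w in auto)
  then show ?thesis
  proof (cases "h w = 0")
    case True
    then show ?thesis using simple w by simp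
  next
    case False
    with \<open>norm (q w) \<le> M\<close> show ?thesis by (simp add: q_def norm_divide field_simps)
  qed
qed

text \<open>A Gronwall argument on a disc with \<open>\<bar>M\<bar> * e \<le> 1 / 2\<close>:
  integrating from the zero \<open>z\<close>, the maximum of \<open>norm k\<close> is at most half
  of itself.\<close>

lemma zero_if_deriv_le:
  assumes k: "k holomorphic_on ball z R" and R: "R > 0" and k0: "k z = 0"
    and le: "\<And>w. w \<in> ball z R \<Longrightarrow> norm (deriv k w) \<le> M * norm (k w)"
  shows "\<exists>e>0. \<forall>w\<in>ball z e. k w = 0"
proof -
  define e where "e = min (R / 2) (1 / (2 * (\<bar>M\<bar> + 1)))"
  have e: "e > 0" "e < R" using R by (auto simp: e_def add_nonneg_pos)
  have eM: "\<bar>M\<bar> * e \<le> 1 / 2"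
  proof -
    have "\<bar>M\<bar> * e \<le> \<bar>M\<bar> * (1 / (2 * (\<bar>M\<bar> + 1)))" by (intro mult_left_mono) (auto simp: e_def)
    also have "\<dots> \<le> 1 / 2" by (simp add: field_simps)
    finally show ?thesis .
  qed
  have sub: "cball z e \<subseteq> ball z R" using e by auto
  have "continuous_on (cball z e) (\<lambda>w. norm (k w))"
    by (intro continuous_intros holomorphic_on_imp_continuous_on holomorphic_on_subset[OF k] sub)
  then obtain x where x: "x \<in> cball z e" "\<And>w. w \<in> cball z e \<Longrightarrow> norm (k w) \<le> norm (k x)"
    using continuous_attains_sup[of "cball z e" "\<lambda>w. norm (k w)"] e by auto
  have "norm (k x - k z) \<le> (\<bar>M\<bar> * norm (k x)) * norm (x - z)"
  proof (rule field_differentiable_bound[OF convex_cball])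
    fix w assume w: "w \<in> cball z e"
    then have wR: "w \<in> ball z R" using sub by blast
    show "(k has_field_derivative deriv k w) (at w within cball z e)"
      using holomorphic_derivI[OF k _ wR] by (auto intro: has_field_derivative_at_within)
    have "M * norm (k w) \<le> \<bar>M\<bar> * norm (k w)" by (intro mult_right_mono) auto
    also have "\<dots> \<le> \<bar>M\<bar> * norm (k x)" using x(2)[OF w] by (intro mult_left_mono) auto
    finally show "norm (deriv k w) \<le> \<bar>M\<bar> * norm (k x)" using le[OF wR] by linarith
  qed (use x e in auto)
  also have "\<dots> \<le> (\<bar>M\<bar> * norm (k x)) * e"
    using x(1) by (intro mult_left_mono) (auto simp: dist_norm norm_minus_commute)
  also have "\<dots> = (\<bar>M\<bar> * e) * norm (k x)" by simp
  also have "\<dots> \<le> 1 / 2 * norm (k x)" using eM by (intro mult_right_mono) auto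
  finally have "k x = 0" using k0 by simp
  then have "k w = 0" if "w \<in> ball z e" for w using x(2)[of w] that by auto
  then show ?thesis using e by blast
qed

section \<open>Marty's theorem\<close>

text \<open>The bound on the spherical derivative, multiplied out. Poles are exempt because the
  dummy value 0 carries no information there; the chart \<open>inverse G\<close> takes care of
  them.\<close>

definition sph_deriv_le :: "(complex \<Rightarrow> complex) \<Rightarrow> real \<Rightarrow> complex set \<Rightarrow> bool" where
  "sph_deriv_le G C S \<longleftrightarrow>
     (\<forall>z\<in>S. \<not> is_pole G z \<longrightarrow> norm (deriv G z) \<le> C * (1 + (norm (G z))\<^sup>2))"

lemma nicely_meromorphic_nonzero_not_pole:
  "G nicely_meromorphic_on UNIV \<Longrightarrow> G z \<noteq> 0 \<Longrightarrow> \<not> is_pole G z"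
  using is_pole_zero_at_nicely_mero by blast

text \<open>The spherical derivative is invariant under inversion. The computation needs
  \<open>G\<close> finite and nonzero; the poles of \<open>G\<close>, where \<open>inverse G\<close>
  is regular, are reached by continuity from a punctured neighbourhood, for which \<open>S\<close>
  is open.\<close>

lemma sph_deriv_le_inverse:
  assumes G: "G nicely_meromorphic_on UNIV" and S: "open S" and le: "sph_deriv_le G C S"
  shows "sph_deriv_le (\<lambda>z. inverse (G z)) C S"
proof (cases "\<forall>z. G z = 0")
  \<comment> \<open>The zero function is its own inverse, as \<open>inverse 0 = 0\<close>; in all
    other cases zeros are isolated.\<close>
  case True
  then have "(\<lambda>z. inverse (G z)) = G" by auto
  then show ?thesis using le by simp
next
  case False
  then have "\<forall>\<^sub>\<approx>x\<in>UNIV. G x \<noteq> 0"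
    using nicely_meromorphic_imp_constant_or_avoid[OF G open_UNIV connected_UNIV, of 0] by auto
  then have nz: "\<forall>\<^sub>F u in at z. G u \<noteq> 0" for z
    by (rule eventually_cosparse_imp_eventually_at[where B = UNIV]) auto
  define k where "k = (\<lambda>z. inverse (G z))"
  have kn: "k nicely_meromorphic_on UNIV" unfolding k_def by (rule nicely_meromorphic_on_inverse[OF G])
  have "norm (deriv k z) \<le> C * (1 + (norm (k z))\<^sup>2)" if z: "z \<in> S" "\<not> is_pole k z" for z
  proof -
    have an: "k analytic_on {z}" using nicely_meromorphic_on_imp_analytic_at[OF kn _ z(2)] by simp
    have "(deriv k \<longlongrightarrow> deriv k z) (at z)" "(k \<longlongrightarrow> k z) (at z)"
      using analytic_at_imp_isCont[OF an] analytic_at_imp_isCont[OF analytic_deriv[OF an]]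
      by (simp_all add: isCont_def)
    then have lim: "((\<lambda>u. norm (deriv k u)) \<longlongrightarrow> norm (deriv k z)) (at z)"
      "((\<lambda>u. C * (1 + (norm (k u))\<^sup>2)) \<longlongrightarrow> C * (1 + (norm (k z))\<^sup>2)) (at z)"
      by (auto intro!: tendsto_intros)
    have "\<forall>\<^sub>F u in at z. u \<in> S" using S z by (simp add: eventually_at_topological) blast
    then have "\<forall>\<^sub>F u in at z. norm (deriv k u) \<le> C * (1 + (norm (k u))\<^sup>2)"
      using nz[of z]
    proof eventually_elim
      case (elim u)
      have np: "\<not> is_pole G u" using nicely_meromorphic_nonzero_not_pole[OF G elim(2)] .
      then have "G analytic_on {u}" using nicely_meromorphic_on_imp_analytic_at[OF G] by simp
      then have "(G has_field_derivative deriv G u) (at u)"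
        by (simp add: analytic_on_imp_differentiable_at DERIV_deriv_iff_field_differentiable)
      then have "(k has_field_derivative - (inverse (G u) * deriv G u * inverse (G u))) (at u)"
        unfolding k_def using elim(2) by (rule DERIV_inverse')
      then have "norm (deriv k u) = norm (deriv G u) / (norm (G u))\<^sup>2"
        by (simp add: DERIV_imp_deriv norm_mult norm_inverse power2_eq_square divide_inverse)
      also have "\<dots> \<le> C * (1 + (norm (G u))\<^sup>2) / (norm (G u))\<^sup>2"
        using le elim(1) np by (intro divide_right_mono) (auto simp: sph_deriv_le_def)
      also have "\<dots> = C * (1 + (norm (k u))\<^sup>2)"
      proof -
        have "C * (1 + g\<^sup>2) / g\<^sup>2 = C * (1 + (1 / g)\<^sup>2)" if "g \<noteq> 0" for g :: real
          using that by (simp add: field_simps)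
        then show ?thesis using elim(2) by (simp add: k_def norm_inverse inverse_eq_divide norm_divide)
      qed
      finally show ?case .
    qed
    then show ?thesis using lim by (intro tendsto_le[OF _ lim(2) lim(1)]) auto
  qed
  then show ?thesis by (simp add: sph_deriv_le_def k_def)
qed

text \<open>A continuity argument along the segment from \<open>z\<close> to \<open>w\<close>: while
  \<open>norm G < 2\<close>, the derivative is at most \<open>C * (1 + 4)\<close>, so
  \<open>G\<close> moves by at most \<open>5 * C * d \<le> 1 / 2\<close> and \<open>norm G\<close>
  stays below 3/2. Hence 2 is never reached; this is the origin of the factor 10.\<close>

lemma bounded_on_small_disc:
  assumes G: "G nicely_meromorphic_on UNIV" and le: "sph_deriv_le G C (ball z d)"
    and C: "C \<ge> 0" "10 * C * d \<le> 1" and z: "\<not> is_pole G z" "norm (G z) \<le> 1" and w: "w \<in> ball z d"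
  shows "\<not> is_pole G w \<and> norm (G w) \<le> 2"
proof -
  define U where "U = {u. \<not> is_pole G u \<and> norm (G u) < 2}"
  have an: "G analytic_on {u}" if "\<not> is_pole G u" for u
    using nicely_meromorphic_on_imp_analytic_at[OF G _ that] by simp
  have "open U"
  proof (rule openI)
    fix u assume u: "u \<in> U"
    then obtain s where s: "open s" "u \<in> s" "G holomorphic_on s"
      using an[of u] analytic_at by (auto simp: U_def)
    have "open (s \<inter> G -` {y. norm y < 2})"
      by (intro continuous_open_preimage holomorphic_on_imp_continuous_on s open_Collect_less continuous_intros)
    then obtain e where "e > 0" "ball u e \<subseteq> s \<inter> G -` {y. norm y < 2}"
      using u s(2) by (force simp: U_def open_contains_ball)
    moreover have "s \<inter> G -` {y. norm y < 2} \<subseteq> U"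
      using not_is_pole_holomorphic[OF s(1) _ s(3)] by (auto simp: U_def)
    ultimately show "\<exists>e>0. ball u e \<subseteq> U" by blast
  qed
  define \<gamma> where "\<gamma> = (\<lambda>s. z + of_real s * (w - z))"
  have cont: "continuous_on A \<gamma>" for A unfolding \<gamma>_def by (intro continuous_intros)
  have in_ball: "\<gamma> s \<in> ball z d" "norm (\<gamma> s - z) \<le> d" if "0 \<le> s" "s \<le> 1" for s
  proof -
    have "norm (\<gamma> s - z) \<le> 1 * norm (w - z)"
      using that unfolding \<gamma>_def by (auto simp: norm_mult intro: mult_left_le_one_le)
    also have "\<dots> < d" using w by (simp add: dist_norm norm_minus_commute)
    finally show "\<gamma> s \<in> ball z d" "norm (\<gamma> s - z) \<le> d" by (simp_all add: dist_norm norm_minus_commute)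
  qed
  have "w \<in> U"
  proof (rule ccontr)
    assume wU: "w \<notin> U"
    define K where "K = {0..1} \<inter> \<gamma> -` (- U)"
    have "compact K" unfolding K_def
      by (intro closed_Int_compact[of _ "{0..1::real}", unfolded Int_commute[of _ "{0..1}"]]
          continuous_closed_preimage cont compact_Int_closed closed_vimage)
        (use \<open>open U\<close> cont in \<open>auto intro: closed_vimage simp: closed_Compl\<close>)
    moreover have "1 \<in> K" using wU by (simp add: K_def \<gamma>_def)
    ultimately obtain s0 where s0: "s0 \<in> K" "\<And>t. t \<in> K \<Longrightarrow> s0 \<le> t"
      using compact_attains_inf[of K] by blast
    have "\<gamma> 0 \<in> U" using z by (simp add: \<gamma>_def U_def)
    then have "s0 \<noteq> 0" using s0(1) by (auto simp: K_def)
    then have s01: "0 < s0" "s0 \<le> 1" using s0(1) by (auto simp: K_def)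
    have below: "\<gamma> t \<in> U" if "0 \<le> t" "t < s0" for t
      using s0(2)[of t] that s01 by (force simp: K_def)
    have small: "norm (G (\<gamma> t)) \<le> 3 / 2" if t: "0 \<le> t" "t < s0" for t
    proof -
      have seg: "\<exists>t'. 0 \<le> t' \<and> t' \<le> t \<and> u = \<gamma> t'" if u: "u \<in> closed_segment z (\<gamma> t)" for u
      proof -
        obtain v where v: "0 \<le> v" "v \<le> 1" "u = (1 - v) *\<^sub>R z + v *\<^sub>R \<gamma> t"
          using u by (auto simp: closed_segment_def)
        then have "u = \<gamma> (v * t)" by (simp add: \<gamma>_def scaleR_conv_of_real algebra_simps)
        moreover have "v * t \<le> t" using v t by (simp add: mult_left_le_one_le)
        ultimately show ?thesis using v t by (intro exI[of _ "v * t"]) auto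
      qed
      have "norm (G (\<gamma> t) - G z) \<le> (C * 5) * norm (\<gamma> t - z)"
      proof (rule field_differentiable_bound[of "closed_segment z (\<gamma> t)"])
        fix u assume "u \<in> closed_segment z (\<gamma> t)"
        then obtain t' where t': "0 \<le> t'" "t' \<le> t" "u = \<gamma> t'" using seg by blast
        then have uU: "u \<in> U" using below t by auto
        then have "G analytic_on {u}" using an by (simp add: U_def)
        then have "(G has_field_derivative deriv G u) (at u)"
          by (simp add: analytic_on_imp_differentiable_at DERIV_deriv_iff_field_differentiable)
        then show "(G has_field_derivative deriv G u) (at u within closed_segment z (\<gamma> t))"
          by (rule has_field_derivative_at_within)
        have "u \<in> ball z d" using in_ball(1)[of t'] t' t s01 by simp
        then have "norm (deriv G u) \<le> C * (1 + (norm (G u))\<^sup>2)"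
          using le uU unfolding sph_deriv_le_def U_def by blast
        also have "(norm (G u))\<^sup>2 \<le> 2\<^sup>2" using uU by (intro power_mono) (auto simp: U_def)
        then have "C * (1 + (norm (G u))\<^sup>2) \<le> C * 5" using C by (intro mult_left_mono) auto
        finally show "norm (deriv G u) \<le> C * 5" .
      qed auto
      also have "\<dots> \<le> (C * 5) * d" using in_ball(2)[of t] t s01 C by (intro mult_left_mono) auto
      finally show ?thesis using C z(2) norm_triangle_ineq2[of "G (\<gamma> t)" "G z"] by argo
    qed
    \<comment> \<open>The first exit point from \<open>U\<close>. Values near it are poles or have
      norm above 3/2, either because \<open>w0\<close> is a pole or by continuity; approaching it
      along the segment contradicts \<open>small\<close>.\<close>
    define w0 where "w0 = \<gamma> s0"
    have "\<forall>\<^sub>F u in nhds w0. is_pole G u \<or> norm (G u) > 3 / 2"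
    proof (cases "is_pole G w0")
      case True
      then have "\<forall>\<^sub>F u in at w0. norm (G u) > 3 / 2"
        unfolding is_pole_def filterlim_at_infinity_conv_norm_at_top filterlim_at_top_dense by blast
      then have "\<forall>\<^sub>F u in at w0. is_pole G u \<or> norm (G u) > 3 / 2" by eventually_elim simp
      then show ?thesis using True by (simp add: eventually_nhds_conv_at)
    next
      case False
      then have "norm (G w0) > 3 / 2" using s0(1) by (auto simp: K_def U_def w0_def)
      moreover have "((\<lambda>u. norm (G u)) \<longlongrightarrow> norm (G w0)) (nhds w0)"
        using analytic_at_imp_isCont[OF an[OF False]]
        by (auto simp: continuous_within tendsto_at_iff_tendsto_nhds intro: tendsto_norm)
      ultimately have "\<forall>\<^sub>F u in nhds w0. norm (G u) > 3 / 2" by (rule order_tendstoD(1)[rotated])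
      then show ?thesis by eventually_elim simp
    qed
    moreover have "(\<gamma> \<longlongrightarrow> w0) (at_left s0)" unfolding w0_def \<gamma>_def by (intro tendsto_intros)
    ultimately have "\<forall>\<^sub>F t in at_left s0. is_pole G (\<gamma> t) \<or> norm (G (\<gamma> t)) > 3 / 2"
      by (rule eventually_compose_filterlim)
    moreover have "\<forall>\<^sub>F t in at_left s0. 0 < t \<and> t < s0"
      using eventually_at_left_real[OF s01(1)] by (auto elim: eventually_mono)
    ultimately have "\<forall>\<^sub>F t in at_left s0. False"
    proof eventually_elim
      case (elim t)
      then show False using small[of t] below[of t] by (auto simp: U_def)
    qed
    then show False by simp
  qed
  then show ?thesis by (simp add: U_def)
qed

text \<open>By invariance under inversion, \<open>bounded_on_small_disc\<close> applies to
  \<open>G\<close> or to \<open>inverse G\<close>, whichever is at most 1 in norm at the centre. The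
  last clause holds since a zero of \<open>G\<close> that is no pole would be a pole of
  \<open>inverse G\<close>.\<close>

lemma small_disc_dichotomy:
  assumes G: "G nicely_meromorphic_on UNIV" and le: "sph_deriv_le G C (ball z d)"
    and C: "C \<ge> 0" "10 * C * d \<le> 1" and d: "d > 0"
  shows "(\<forall>w\<in>ball z d. \<not> is_pole G w \<and> norm (G w) \<le> 2) \<or>
    (\<forall>w\<in>ball z d. \<not> is_pole (\<lambda>u. inverse (G u)) w \<and> norm (inverse (G w)) \<le> 2 \<and>
       (G w = 0 \<longrightarrow> is_pole G w))"
proof (cases "\<not> is_pole G z \<and> norm (G z) \<le> 1")
  case True
  then show ?thesis using bounded_on_small_disc[OF G le C] by blast
next
  case False
  define k where "k = (\<lambda>z. inverse (G z))"
  have kn: "k nicely_meromorphic_on UNIV" unfolding k_def by (rule nicely_meromorphic_on_inverse[OF G])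
  have lek: "sph_deriv_le k C (ball z d)" unfolding k_def by (rule sph_deriv_le_inverse[OF G open_ball le])
  have "\<not> is_pole k z"
  proof
    assume "is_pole k z"
    then have iz: "isolated_zero G z" by (simp add: k_def is_pole_inverse_iff)
    then have "G z = 0" using zero_isolated_zero_nicely_meromorphic G nicely_meromorphic_on_subset by blast
    then show False using False iz pole_is_not_zero by auto
  qed
  moreover have "norm (k z) \<le> 1"
    using False is_pole_zero_at_nicely_mero[OF G, of z]
    by (cases "G z = 0") (auto simp: k_def norm_inverse inverse_le_1_iff)
  ultimately have 1: "\<forall>w\<in>ball z d. \<not> is_pole k w \<and> norm (k w) \<le> 2"
    using bounded_on_small_disc[OF kn lek C] by blast
  have nc: "\<not> (\<forall>w. G w = 0)"
  proof
    assume "\<forall>w. G w = 0"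
    then have "G = (\<lambda>_. 0)" by auto
    then show False using False by simp
  qed
  then have "\<forall>\<^sub>\<approx>x\<in>UNIV. G x \<noteq> 0"
    using nicely_meromorphic_imp_constant_or_avoid[OF G open_UNIV connected_UNIV, of 0] by auto
  then have nz: "\<forall>\<^sub>F u in at w. G u \<noteq> 0" for w
    by (rule eventually_cosparse_imp_eventually_at[where B = UNIV]) auto
  have "is_pole G w" if "w \<in> ball z d" "G w = 0" for w
    using zero_or_pole[OF G _ that(2) nz] 1 that(1) by (auto simp: k_def is_pole_inverse_iff)
  then show ?thesis using 1 by (auto simp: k_def)
qed

section \<open>Uniform convergence on discs in the two charts of the sphere\<close>

text \<open>Holomorphy is asked of a tail only, so the notion ignores finitely many members, as the
  diagonal sequence requires.\<close>

definition disc_conv :: "(nat \<Rightarrow> complex \<Rightarrow> complex) \<Rightarrow> complex set \<Rightarrow> (complex \<Rightarrow> complex) \<Rightarrow> bool" where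
  "disc_conv F U h \<longleftrightarrow> h holomorphic_on U \<and> (\<forall>\<^sub>F n in sequentially. F n holomorphic_on U) \<and>
     uniform_limit U F h sequentially"

text \<open>
  Since \<open>inverse 0 = 0\<close> and the value at a pole is 0, zeros of \<open>F n\<close> would pass for poles here unless
  they are excluded explicitly.
\<close>

definition disc_conv_inverse :: "(nat \<Rightarrow> complex \<Rightarrow> complex) \<Rightarrow> complex set \<Rightarrow> (complex \<Rightarrow> complex) \<Rightarrow> bool" where
  "disc_conv_inverse F U k \<longleftrightarrow> disc_conv (\<lambda>n w. inverse (F n w)) U k \<and>
     (\<forall>\<^sub>F n in sequentially. \<forall>w\<in>U. F n w = 0 \<longrightarrow> is_pole (F n) w)"

definition sphere_inverse :: "complex \<Rightarrow> riemann_sphere" where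
  "sphere_inverse x = (if x = 0 then Infty else Finite (inverse x))"

text \<open>The limit is a sphere-valued function rather than a function in a chart, so that limits
  found on different discs can be compared and glued.\<close>

definition conv_chart ::
    "(nat \<Rightarrow> complex \<Rightarrow> complex) \<Rightarrow> (complex \<Rightarrow> riemann_sphere) \<Rightarrow> complex set \<Rightarrow> bool" where
  "conv_chart F L U \<longleftrightarrow>
    (\<exists>h. disc_conv F U h \<and> (\<forall>w\<in>U. L w = Finite (h w))) \<or>
    (\<exists>k. disc_conv_inverse F U k \<and> (\<forall>w\<in>U. L w = sphere_inverse (k w)))"

lemma disc_conv_subset: "disc_conv F U h \<Longrightarrow> V \<subseteq> U \<Longrightarrow> disc_conv F V h"
  unfolding disc_conv_def
  by (auto intro: holomorphic_on_subset uniform_limit_on_subset elim: eventually_mono)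

lemma disc_conv_inverse_subset: "disc_conv_inverse F U h \<Longrightarrow> V \<subseteq> U \<Longrightarrow> disc_conv_inverse F V h"
  unfolding disc_conv_inverse_def
  by (elim conjE, intro conjI, erule (1) disc_conv_subset, erule eventually_mono, blast)

lemma conv_chart_subset: "conv_chart F L U \<Longrightarrow> V \<subseteq> U \<Longrightarrow> conv_chart F L V"
  unfolding conv_chart_def using disc_conv_subset disc_conv_inverse_subset by blast

lemma disc_conv_subseq:
  assumes "disc_conv F U h" "strict_mono r"
  shows "disc_conv (F \<circ> r) U h"
  using assms(1) unfolding disc_conv_def uniform_limit_iff o_def
  by (auto intro: eventually_subseq[OF assms(2)])

lemma conv_chart_subseq:
  assumes "conv_chart F L U" "strict_mono r"
  shows "conv_chart (F \<circ> r) L U"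
proof -
  have "disc_conv_inverse (F \<circ> r) U k" if "disc_conv_inverse F U k" for k
    using disc_conv_subseq[of "\<lambda>n w. inverse (F n w)" U k r] eventually_subseq[OF assms(2)] assms(2) that
    unfolding disc_conv_inverse_def o_def by blast
  then show ?thesis using assms disc_conv_subseq unfolding conv_chart_def by blast
qed

lemma eventually_sequentially_shiftD:
  "(\<forall>\<^sub>F n in sequentially. P (m + n)) \<Longrightarrow> \<forall>\<^sub>F n in sequentially. P n"
  using eventually_sequentially_seg[of P m] by (simp add: add.commute)

lemma disc_conv_shift:
  assumes "disc_conv (\<lambda>n. F (m + n)) U h"
  shows "disc_conv F U h"
proof -
  have "\<forall>\<^sub>F n in sequentially. F n holomorphic_on U"
    using assms by (intro eventually_sequentially_shiftD[of "\<lambda>n. F n holomorphic_on U" m]) (simp add: disc_conv_def)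
  moreover have "\<forall>\<^sub>F n in sequentially. \<forall>x\<in>U. dist (F n x) (h x) < e" if "e > 0" for e
    using assms that
    by (intro eventually_sequentially_shiftD[of "\<lambda>n. \<forall>x\<in>U. dist (F n x) (h x) < e" m]) (simp add: disc_conv_def uniform_limit_iff)
  ultimately show ?thesis using assms by (simp add: disc_conv_def uniform_limit_iff)
qed

lemma conv_chart_shift:
  assumes "conv_chart (\<lambda>n. F (m + n)) L U"
  shows "conv_chart F L U"
proof -
  have "disc_conv_inverse F U k" if "disc_conv_inverse (\<lambda>n. F (m + n)) U k" for k
    using disc_conv_shift[of "\<lambda>n w. inverse (F n w)" m U k] that
      eventually_sequentially_shiftD[of "\<lambda>n. \<forall>w\<in>U. F n w = 0 \<longrightarrow> is_pole (F n) w" m]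
    unfolding disc_conv_inverse_def by blast
  then show ?thesis using assms disc_conv_shift unfolding conv_chart_def by blast
qed

text \<open>The pointwise trace of \<open>conv_chart\<close>, free of the choice of a chart. It
  serves to show that limits on overlapping discs agree even if they were found in different
  charts.\<close>

definition point_conv :: "(nat \<Rightarrow> complex \<Rightarrow> complex) \<Rightarrow> complex \<Rightarrow> riemann_sphere \<Rightarrow> bool" where
  "point_conv F w p \<longleftrightarrow> (case p of
      Finite c \<Rightarrow> (\<forall>\<^sub>F n in sequentially. \<not> is_pole (F n) w) \<and> (\<lambda>n. F n w) \<longlonglongrightarrow> c
    | Infty \<Rightarrow> (\<forall>\<^sub>F n in sequentially. F n w = 0 \<longrightarrow> is_pole (F n) w) \<and> (\<lambda>n. inverse (F n w)) \<longlonglongrightarrow> 0)"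

lemma point_conv_unique:
  assumes "point_conv F w p" "point_conv F w q"
  shows "p = q"
proof -
  have False if "point_conv F w (Finite c)" "point_conv F w Infty" for c
  proof -
    have "\<forall>\<^sub>F n in sequentially. F n w * inverse (F n w) = 1"
      using that unfolding point_conv_def by (auto elim: eventually_elim2)
    moreover have "(\<lambda>n. F n w * inverse (F n w)) \<longlonglongrightarrow> c * 0"
      using that unfolding point_conv_def by (intro tendsto_mult) auto
    ultimately have "(\<lambda>n. 1 :: complex) \<longlonglongrightarrow> c * 0"
      by (rule Lim_transform_eventually[rotated])
    then have "c * 0 = 1" using LIMSEQ_unique tendsto_const by blast
    then show False by simp
  qed
  moreover have "c = c'" if "point_conv F w (Finite c)" "point_conv F w (Finite c')" for c c'
    using that LIMSEQ_unique[of "\<lambda>n. F n w" c c'] unfolding point_conv_def by simp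
  ultimately show ?thesis using assms by (cases p; cases q) auto
qed

lemma conv_chart_imp_point_conv:
  assumes F: "\<And>n. F n nicely_meromorphic_on UNIV" and c: "conv_chart F L U" and U: "open U" "w \<in> U"
  shows "point_conv F w (L w)"
  using c unfolding conv_chart_def
proof (elim disjE exE conjE)
  fix h assume h: "disc_conv F U h" "\<forall>w\<in>U. L w = Finite (h w)"
  then have "\<forall>\<^sub>F n in sequentially. \<not> is_pole (F n) w"
    using not_is_pole_holomorphic[OF U] by (auto simp: disc_conv_def elim: eventually_mono)
  moreover have "(\<lambda>n. F n w) \<longlonglongrightarrow> h w"
    using h(1) U(2) tendsto_uniform_limitI[where S = U and f = F and l = h] by (simp add: disc_conv_def)
  ultimately show ?thesis using h U by (simp add: point_conv_def)
next
  fix k assume k: "disc_conv_inverse F U k" "\<forall>w\<in>U. L w = sphere_inverse (k w)"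
  then have lim: "(\<lambda>n. inverse (F n w)) \<longlonglongrightarrow> k w"
    using U(2) tendsto_uniform_limitI[where S = U and f = "\<lambda>n w. inverse (F n w)" and l = k]
    by (simp add: disc_conv_def disc_conv_inverse_def)
  have ev: "\<forall>\<^sub>F n in sequentially. F n w = 0 \<longrightarrow> is_pole (F n) w"
    using k U(2) unfolding disc_conv_inverse_def by (blast intro: eventually_mono)
  show ?thesis
  proof (cases "k w = 0")
    case True
    then show ?thesis using lim ev k U by (simp add: point_conv_def sphere_inverse_def)
  next
    case False
    have "\<forall>\<^sub>F n in sequentially. inverse (F n w) \<noteq> 0"
      using lim False by (rule tendsto_imp_eventually_ne)
    then have "\<forall>\<^sub>F n in sequentially. \<not> is_pole (F n) w"
      using nicely_meromorphic_nonzero_not_pole[OF F] by (auto elim: eventually_mono)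
    moreover have "(\<lambda>n. F n w) \<longlonglongrightarrow> inverse (k w)" using tendsto_inverse[OF lim False] by simp
    ultimately show ?thesis using k U False by (simp add: point_conv_def sphere_inverse_def)
  qed
qed

text \<open>Montel's theorem gives uniform convergence on compact subsets only, hence the halved
  radius.\<close>

lemma Montel_disc:
  fixes F :: "nat \<Rightarrow> complex \<Rightarrow> complex"
  assumes "\<And>n. F n holomorphic_on ball z d" and "\<And>n w. w \<in> ball z d \<Longrightarrow> norm (F n w) \<le> B" and "d > 0"
  obtains r h where "strict_mono r" "disc_conv (F \<circ> r) (ball z (d / 2)) h"
proof -
  define H where "H = {f. f holomorphic_on ball z d \<and> (\<forall>w\<in>ball z d. norm (f w) \<le> B)}"
  obtain h r where hr: "h holomorphic_on ball z d" "strict_mono (r :: nat \<Rightarrow> nat)"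
    "\<And>K. compact K \<Longrightarrow> K \<subseteq> ball z d \<Longrightarrow> uniform_limit K (F \<circ> r) h sequentially"
  proof (rule Montel[of "ball z d" H F])
    show "\<exists>B. \<forall>h\<in>H. \<forall>z\<in>K. norm (h z) \<le> B" if "compact K" "K \<subseteq> ball z d" for K
      using that by (intro exI[of _ B]) (auto simp: H_def)
    show "range F \<subseteq> H" using assms by (auto simp: H_def)
  qed (auto simp: H_def)
  have sub: "ball z (d / 2) \<subseteq> cball z (d / 2)" "cball z (d / 2) \<subseteq> ball z d" using assms(3) by auto
  then have "uniform_limit (ball z (d / 2)) (F \<circ> r) h sequentially"
    by (intro uniform_limit_on_subset[OF hr(3)]) auto
  moreover have "F n holomorphic_on ball z (d / 2)" for n
    using assms(1) by (rule holomorphic_on_subset) (use sub in blast)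
  moreover have "h holomorphic_on ball z (d / 2)"
    using hr(1) by (rule holomorphic_on_subset) (use sub in blast)
  ultimately have "disc_conv (F \<circ> r) (ball z (d / 2)) h" by (simp add: disc_conv_def)
  then show ?thesis using that hr(2) by blast
qed

text \<open>The radius is fixed before the subsequence \<open>s\<close>: the discs that cover the
  plane must be known before the diagonal extraction begins.\<close>

lemma Marty_local:
  assumes F: "\<And>n. F n nicely_meromorphic_on UNIV" and d: "d > 0"
    and le: "\<forall>\<^sub>F n in sequentially. sph_deriv_le (F n) C (ball z d)"
  shows "\<exists>e>0. \<forall>s :: nat \<Rightarrow> nat. strict_mono s \<longrightarrow> (\<exists>r. strict_mono r \<and> (\<exists>L. conv_chart (F \<circ> (s \<circ> r)) L (ball z e)))"
proof -
  define C' where "C' = \<bar>C\<bar>"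
  define e where "e = min d (1 / (10 * (C' + 1)))"
  have C': "C' \<ge> 0" "C \<le> C'" by (auto simp: C'_def)
  have e: "e > 0" "e \<le> d" using d C' by (auto simp: e_def)
  have "10 * C' * e \<le> 10 * C' * (1 / (10 * (C' + 1)))"
    using C' by (intro mult_left_mono) (auto simp: e_def)
  also have "\<dots> \<le> 1" using C' by (simp add: field_simps)
  finally have Ce: "10 * C' * e \<le> 1" .
  define A where "A n \<longleftrightarrow> (\<forall>w\<in>ball z e. \<not> is_pole (F n) w \<and> norm (F n w) \<le> 2)" for n :: nat
  define B where "B n \<longleftrightarrow> (\<forall>w\<in>ball z e. \<not> is_pole (\<lambda>u. inverse (F n u)) w \<and> norm (inverse (F n w)) \<le> 2 \<and>
       (F n w = 0 \<longrightarrow> is_pole (F n) w))" for n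
  have AB: "\<forall>\<^sub>F n in sequentially. A n \<or> B n"
    using le
  proof eventually_elim
    case (elim n)
    have "sph_deriv_le (F n) C' (ball z e)"
      unfolding sph_deriv_le_def
    proof (intro ballI impI)
      fix w assume w: "w \<in> ball z e" "\<not> is_pole (F n) w"
      then have "norm (deriv (F n) w) \<le> C * (1 + (norm (F n w))\<^sup>2)"
        using elim e unfolding sph_deriv_le_def by auto
      also have "\<dots> \<le> C' * (1 + (norm (F n w))\<^sup>2)" using C' by (intro mult_right_mono) auto
      finally show "norm (deriv (F n) w) \<le> C' * (1 + (norm (F n w))\<^sup>2)" .
    qed
    from small_disc_dichotomy[OF F this C'(1) Ce e(1)] show ?case unfolding A_def B_def .
  qed
  have "\<exists>r. strict_mono r \<and> (\<exists>L. conv_chart (F \<circ> (s \<circ> r)) L (ball z (e / 2)))" if s: "strict_mono s" for s :: "nat \<Rightarrow> nat"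
  proof (cases "\<forall>\<^sub>F n in sequentially. \<not> A (s n)")
    \<comment> \<open>Infinitely many members are bounded on the disc, and Montel's theorem applies
      in the finite chart. In the other case almost all satisfy \<open>B\<close>, and it applies to
      the inverses.\<close>
    case False
    then obtain r :: "nat \<Rightarrow> nat" where r: "strict_mono r" "\<And>n. A (s (r n))"
      using not_eventually_sequentiallyD[OF False] by auto
    have "F (s (r n)) holomorphic_on ball z e" for n
      using r(2)[of n] nicely_meromorphic_without_singularities[of "F (s (r n))" "ball z e"]
        nicely_meromorphic_on_subset[OF F] analytic_imp_holomorphic by (auto simp: A_def)
    then obtain q h where q: "strict_mono q" "disc_conv ((\<lambda>n. F (s (r n))) \<circ> q) (ball z (e / 2)) h"
      using Montel_disc[of "\<lambda>n. F (s (r n))" z e 2] r(2) e by (auto simp: A_def)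
    then have "conv_chart (F \<circ> (s \<circ> (r \<circ> q))) (\<lambda>w. Finite (h w)) (ball z (e / 2))"
      unfolding conv_chart_def by (auto simp: o_def)
    then show ?thesis using strict_mono_o[OF r(1) q(1)] by blast
  next
    case True
    then have "\<forall>\<^sub>F n in sequentially. B (s n)"
      using eventually_subseq[OF s AB] by eventually_elim simp
    then obtain N where N: "\<And>n. n \<ge> N \<Longrightarrow> B (s n)" by (auto simp: eventually_sequentially)
    define r where "r = (\<lambda>n. n + N)"
    have r: "strict_mono r" by (simp add: r_def strict_mono_def)
    have Br: "B (s (r n))" for n using N by (simp add: r_def)
    have "(\<lambda>w. inverse (F (s (r n)) w)) holomorphic_on ball z e" for n
      using Br[of n] nicely_meromorphic_without_singularities[of "\<lambda>w. inverse (F (s (r n)) w)" "ball z e"]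
        nicely_meromorphic_on_subset[OF nicely_meromorphic_on_inverse[OF F]] analytic_imp_holomorphic
      by (auto simp: B_def)
    then obtain q k where q: "strict_mono q" "disc_conv ((\<lambda>n w. inverse (F (s (r n)) w)) \<circ> q) (ball z (e / 2)) k"
      using Montel_disc[of "\<lambda>n w. inverse (F (s (r n)) w)" z e 2] Br e by (auto simp: B_def)
    moreover have "ball z (e / 2) \<subseteq> ball z e" using e by auto
    then have "\<forall>w\<in>ball z (e / 2). F (s (r (q n))) w = 0 \<longrightarrow> is_pole (F (s (r (q n)))) w" for n
      using Br[of "q n"] unfolding B_def by blast
    ultimately have "disc_conv_inverse (F \<circ> (s \<circ> (r \<circ> q))) (ball z (e / 2)) k"
      unfolding disc_conv_inverse_def by (simp add: o_def)
    then have "conv_chart (F \<circ> (s \<circ> (r \<circ> q))) (\<lambda>w. sphere_inverse (k w)) (ball z (e / 2))"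
      unfolding conv_chart_def by auto
    then show ?thesis using strict_mono_o[OF r q(1)] by blast
  qed
  then show ?thesis using e by (intro exI[of _ "e / 2"]) auto
qed

text \<open>Lindelof's theorem leaves countably many discs, a diagonal sequence converges on each of
  them, and uniqueness of pointwise limits glues the local limits.\<close>

theorem Marty:
  assumes F: "\<And>n. F n nicely_meromorphic_on UNIV"
    and le: "\<And>z. \<exists>d>0. \<exists>C. \<forall>\<^sub>F n in sequentially. sph_deriv_le (F n) C (ball z d)"
  obtains r L where "strict_mono r" "\<And>z. \<exists>d>0. conv_chart (F \<circ> r) L (ball z d)"
proof -
  have "\<forall>z. \<exists>e>0. \<forall>s :: nat \<Rightarrow> nat. strict_mono s \<longrightarrow> (\<exists>r. strict_mono r \<and> (\<exists>L. conv_chart (F \<circ> (s \<circ> r)) L (ball z e)))"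
    using Marty_local[of F, OF F] le by blast
  then obtain \<delta> where \<delta>: "\<And>z. \<delta> z > 0"
    "\<And>z (s :: nat \<Rightarrow> nat). strict_mono s \<Longrightarrow> \<exists>r. strict_mono r \<and> (\<exists>L. conv_chart (F \<circ> (s \<circ> r)) L (ball z (\<delta> z)))"
    by metis
  define \<B> where "\<B> = range (\<lambda>z. ball z (\<delta> z))"
  obtain \<C> where \<C>: "\<C> \<subseteq> \<B>" "countable \<C>" "\<Union>\<C> = \<Union>\<B>"
    using Lindelof[of \<B>] by (auto simp: \<B>_def)
  have cover: "\<Union>\<C> = UNIV" using \<C>(3) \<delta>(1) by (force simp: \<B>_def)
  then have ne: "\<C> \<noteq> {}" by auto
  define U where "U = from_nat_into \<C>"
  have U: "U n \<in> \<B>" for n using from_nat_into[OF ne] \<C>(1) by (auto simp: U_def)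
  have Uopen: "open (U n)" for n using U[of n] by (auto simp: \<B>_def)
  have Ucover: "\<exists>n. z \<in> U n" for z
    using cover range_from_nat_into[OF ne \<C>(2)] unfolding U_def by (metis UNIV_I UnionE imageE)
  interpret subseqs "\<lambda>n s. \<exists>L. conv_chart (F \<circ> s) L (U n)"
  proof
    fix n and s :: "nat \<Rightarrow> nat" assume s: "strict_mono s"
    obtain z where "U n = ball z (\<delta> z)" using U[of n] by (auto simp: \<B>_def)
    then show "\<exists>r'. strict_mono r' \<and> (\<exists>L. conv_chart (F \<circ> (s \<circ> r')) L (U n))"
      using \<delta>(2)[OF s, of z] by simp
  qed
  have "\<exists>L. conv_chart (F \<circ> diagseq) L (U n)" for n
  proof -
    \<comment> \<open>The diagonal sequence is guaranteed to be a subsequence of stage n only from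
      index \<open>Suc n\<close> on; the shift is undone afterwards.\<close>
    have "\<exists>L. conv_chart (F \<circ> (diagseq \<circ> (+) (Suc n))) L (U n)"
    proof (rule diagseq_holds)
      fix r s :: "nat \<Rightarrow> nat" and n assume "strict_mono r" "\<exists>L. conv_chart (F \<circ> s) L (U n)"
      then show "\<exists>L. conv_chart (F \<circ> (s \<circ> r)) L (U n)"
        using conv_chart_subseq[of "F \<circ> s" _ "U n" r] by (auto simp: o_assoc)
    qed
    then show ?thesis using conv_chart_shift[of "F \<circ> diagseq" "Suc n"] by (auto simp: o_def)
  qed
  then have "\<exists>\<Lambda>. \<forall>n. conv_chart (F \<circ> diagseq) (\<Lambda> n) (U n)" by (intro choice allI)
  then obtain \<Lambda> where \<Lambda>: "\<And>n. conv_chart (F \<circ> diagseq) (\<Lambda> n) (U n)" by blast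
  have nice: "(F \<circ> diagseq) n nicely_meromorphic_on UNIV" for n using F by simp
  have agree: "\<Lambda> m w = \<Lambda> n w" if "w \<in> U m" "w \<in> U n" for m n w
    using conv_chart_imp_point_conv[OF nice \<Lambda> Uopen] that point_conv_unique by blast
  define L where "L = (\<lambda>w. \<Lambda> (SOME n. w \<in> U n) w)"
  have L: "L w = \<Lambda> n w" if "w \<in> U n" for n w
    unfolding L_def using agree that someI[of "\<lambda>n. w \<in> U n" n] by blast
  have "\<exists>d>0. conv_chart (F \<circ> diagseq) L (ball z d)" for z
  proof -
    obtain n where n: "z \<in> U n" using Ucover by blast
    then obtain d where d: "d > 0" "ball z d \<subseteq> U n" using Uopen open_contains_ball by blast
    have "conv_chart (F \<circ> diagseq) L (U n)"
      using \<Lambda>[of n] L[of _ n] unfolding conv_chart_def by auto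
    then show ?thesis using d conv_chart_subset by blast
  qed
  then show ?thesis using that[OF subseq_diagseq] by blast
qed

section \<open>Limit functions and the spherical metric\<close>

lemma sphere_inverse_simps [simp]:
  "sphere_inverse 0 = Infty" "x \<noteq> 0 \<Longrightarrow> sphere_inverse x = Finite (inverse x)"
  by (simp_all add: sphere_inverse_def)

lemma nicely_meromorphic_on_UNIV_local:
  assumes "\<And>z. \<exists>g U. open U \<and> z \<in> U \<and> g nicely_meromorphic_on U \<and> (\<forall>u\<in>U. f u = g u)"
  shows "f nicely_meromorphic_on UNIV"
proof -
  have "f meromorphic_on {z} \<and> (is_pole f z \<and> f z = 0 \<or> f \<midarrow>z\<rightarrow> f z)" for z
  proof -
    obtain g U where U: "open U" "z \<in> U" "g nicely_meromorphic_on U" "\<And>u. u \<in> U \<Longrightarrow> f u = g u"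
      using assms[of z] by blast
    have "\<forall>\<^sub>F u in at z. u \<in> U" using U by (auto simp: eventually_at_topological)
    then have ev: "\<forall>\<^sub>F u in at z. f u = g u" by eventually_elim (rule U(4))
    have "f meromorphic_on {z} \<longleftrightarrow> g meromorphic_on {z}"
      by (rule meromorphic_on_cong) (use ev in auto)
    moreover have "g meromorphic_on {z}"
      by (rule meromorphic_on_subset[of _ U]) (use U in \<open>auto simp: nicely_meromorphic_on_def\<close>)
    moreover have "is_pole f z = is_pole g z" by (rule is_pole_cong[OF ev refl])
    moreover have "f \<midarrow>z\<rightarrow> f z \<longleftrightarrow> g \<midarrow>z\<rightarrow> g z"
      using tendsto_cong[OF ev] U by simp
    ultimately show ?thesis using U by (simp add: nicely_meromorphic_on_def)
  qed
  then show ?thesis unfolding nicely_meromorphic_on_def meromorphic_on_def by auto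
qed

text \<open>The interior \<open>T\<close> of the set where \<open>L\<close> is infinite is also
  closed: on a disc meeting \<open>T\<close> the inverse coordinate vanishes on an open set, hence
  throughout. So either \<open>L\<close> is constantly infinite, or its infinities are isolated
  zeros of the inverse coordinate, that is, poles.\<close>

lemma conv_limit_cases:
  assumes conv: "\<And>z. \<exists>d>0. conv_chart F L (ball z d)"
  shows "L = (\<lambda>_. Infty) \<or> (\<exists>h. h nicely_meromorphic_on UNIV \<and> L = to_sphere h)"
proof -
  define T where "T = {z. \<exists>d>0. \<forall>w\<in>ball z d. L w = Infty}"
  have "open T"
  proof (rule openI)
    fix z assume "z \<in> T"
    then obtain d where d: "d > 0" "\<forall>w\<in>ball z d. L w = Infty" by (auto simp: T_def)
    have "w \<in> T" if w: "w \<in> ball z d" for w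
    proof -
      obtain e where "e > 0" "ball w e \<subseteq> ball z d"
        using w open_ball open_contains_ball by blast
      then show ?thesis using d unfolding T_def by blast
    qed
    then show "\<exists>e>0. ball z e \<subseteq> T" using d by blast
  qed
  have zero_in_T: "ball z d \<subseteq> T" if k: "k holomorphic_on ball z d" and L: "\<forall>w\<in>ball z d. L w = sphere_inverse (k w)"
      and w: "w \<in> ball z d" "w \<in> T" for z d k w
  proof -
    obtain e1 where e1: "e1 > 0" "\<And>u. u \<in> ball w e1 \<Longrightarrow> L u = Infty" using w(2) by (auto simp: T_def)
    obtain e2 where e2: "e2 > 0" "ball w e2 \<subseteq> ball z d" using w(1) open_ball open_contains_ball by blast
    define e where "e = min e1 e2"
    have e: "e > 0" "ball w e \<subseteq> ball z d" using e1 e2 by (auto simp: e_def)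
    have k0: "k u = 0" if "u \<in> ball w e" for u
    proof -
      have "u \<in> ball z d" using that e by blast
      moreover have "L u = Infty" using that e1 by (simp add: e_def)
      ultimately show ?thesis using L by (metis riemann_sphere.distinct(1) sphere_inverse_simps(2))
    qed
    have "k u = 0" if u: "u \<in> ball z d" for u
    proof (rule analytic_continuation_open[of "ball w e" "ball z d" k "\<lambda>_. 0" u])
      show "k holomorphic_on ball z d" by (rule k)
    qed (use u e k0 w in auto)
    then have "\<forall>u\<in>ball z d. L u = Infty" using L by simp
    then show ?thesis unfolding T_def using open_ball open_contains_ball by (smt (verit) mem_Collect_eq subset_eq)
  qed
  have "open (- T)"
  proof (rule openI)
    fix z assume z: "z \<in> - T"
    obtain d where d: "d > 0" "conv_chart F L (ball z d)" using conv by blast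
    have "w \<notin> T" if w: "w \<in> ball z d" for w
    proof
      assume wT: "w \<in> T"
      from d(2) show False unfolding conv_chart_def
      proof (elim disjE exE conjE)
        fix h assume "\<forall>w\<in>ball z d. L w = Finite (h w)"
        then have "L w = Finite (h w)" using w by blast
        moreover have "L w = Infty" using wT unfolding T_def by auto
        ultimately show False by simp
      next
        fix k assume "disc_conv_inverse F (ball z d) k" "\<forall>w\<in>ball z d. L w = sphere_inverse (k w)"
        then have "ball z d \<subseteq> T" using zero_in_T[of k z d w] w wT by (auto simp: disc_conv_inverse_def disc_conv_def)
        then show False using z d(1) centre_in_ball by blast
      qed
    qed
    then show "\<exists>e>0. ball z e \<subseteq> - T" using d(1) by blast
  qed
  then have "T = {} \<or> T = UNIV" using \<open>open T\<close> clopen[of T] by (simp add: closed_def)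
  then show ?thesis
  proof
    assume "T = UNIV"
    have "L z = Infty" for z
    proof -
      obtain d where "d > 0" "\<forall>w\<in>ball z d. L w = Infty"
        using \<open>T = UNIV\<close> unfolding T_def by blast
      then show ?thesis by simp
    qed
    then show ?thesis by auto
  next
    assume T: "T = {}"
    \<comment> \<open>The value 0 at infinity is the convention for poles of nicely meromorphic
      functions.\<close>
    define h where "h = (\<lambda>z. case L z of Finite c \<Rightarrow> c | Infty \<Rightarrow> 0)"
    have h: "(\<exists>g U. open U \<and> z \<in> U \<and> g nicely_meromorphic_on U \<and> (\<forall>u\<in>U. h u = g u)) \<and> L z = to_sphere h z" for z
    proof -
      obtain d where d: "d > 0" "conv_chart F L (ball z d)" using conv by blast
      have ev_ball: "\<forall>\<^sub>F u in at z. u \<in> ball z d"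
        by (rule eventually_at_in_open') (use d in auto)
      from d(2) show ?thesis unfolding conv_chart_def
      proof (elim disjE exE conjE)
        fix g assume g: "disc_conv F (ball z d) g" and L: "\<forall>w\<in>ball z d. L w = Finite (g w)"
        then have hg: "\<forall>u\<in>ball z d. h u = g u" by (simp add: h_def)
        have holg: "g holomorphic_on ball z d" using g by (simp add: disc_conv_def)
        have "\<not> is_pole g z" using not_is_pole_holomorphic[OF open_ball _ holg] d by simp
        moreover have "is_pole h z = is_pole g z"
          by (rule is_pole_cong[OF eventually_mono[OF ev_ball] refl]) (use hg in blast)
        ultimately have "L z = to_sphere h z" using L hg d by (simp add: to_sphere_def)
        moreover have "g nicely_meromorphic_on ball z d"
          using holg by (simp add: analytic_on_imp_nicely_meromorphic_on analytic_on_open)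
        ultimately show ?thesis using hg d by (intro conjI exI[of _ g] exI[of _ "ball z d"]) auto
      next
        fix k assume k: "disc_conv_inverse F (ball z d) k" and L: "\<forall>w\<in>ball z d. L w = sphere_inverse (k w)"
        define g where "g = (\<lambda>u. inverse (k u))"
        have hg: "\<forall>u\<in>ball z d. h u = g u" using L by (simp add: h_def g_def sphere_inverse_def)
        have holk: "k holomorphic_on ball z d" using k by (simp add: disc_conv_inverse_def disc_conv_def)
        then have an: "k analytic_on ball z d" by (simp add: analytic_on_open)
        then have "g nicely_meromorphic_on ball z d"
          unfolding g_def by (intro nicely_meromorphic_on_inverse analytic_on_imp_nicely_meromorphic_on)
        moreover have "L z = to_sphere h z"
        proof -
          have eq: "is_pole h z = is_pole g z"
            by (rule is_pole_cong[OF eventually_mono[OF ev_ball] refl]) (use hg in blast)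
          have anz: "k analytic_on {z}" using an d by (auto intro: analytic_on_subset)
          show ?thesis
          proof (cases "k z = 0")
            case True
            have "isolated_zero k z"
            proof (rule ccontr)
              assume "\<not> isolated_zero k z"
              then have "\<forall>\<^sub>F u in nhds z. k u = 0"
                using non_isolated_zero_imp_eventually_zero'[OF anz True] by blast
              moreover have "\<forall>\<^sub>F u in nhds z. u \<in> ball z d"
                by (rule eventually_nhds_in_open) (use d in auto)
              ultimately have "\<forall>\<^sub>F u in nhds z. L u = Infty" by eventually_elim (use L in simp)
              then have "z \<in> T" unfolding T_def eventually_nhds_metric by (auto simp: dist_commute)
              then show False using T by simp
            qed
            then show ?thesis using eq L d True by (simp add: to_sphere_def g_def is_pole_inverse_iff)
          next
            case False
            then have "\<not> isolated_zero k z" using zero_isolated_zero_analytic[OF _ anz] by blast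
            then show ?thesis using eq L d False hg
              by (simp add: to_sphere_def g_def is_pole_inverse_iff)
          qed
        qed
        ultimately show ?thesis using hg d by (intro conjI exI[of _ g] exI[of _ "ball z d"]) auto
      qed
    qed
    then have "h nicely_meromorphic_on UNIV" by (intro nicely_meromorphic_on_UNIV_local) blast
    moreover have "L = to_sphere h" using h by blast
    ultimately show ?thesis by blast
  qed
qed

lemma chordal_dist_Finite_le: "chordal_dist (Finite x) (Finite y) \<le> norm (x - y)"
proof -
  have "1 * 1 \<le> sqrt (1 + (norm x)\<^sup>2) * sqrt (1 + (norm y)\<^sup>2)" by (intro mult_mono) auto
  then show ?thesis by (simp add: divide_le_eq mult_le_cancel_left1)
qed

lemma chordal_dist_nonneg: "chordal_dist p q \<ge> 0"
  by (cases p; cases q) auto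

text \<open>Inversion is a chordal isometry:
  \<open>norm x * sqrt (1 + (norm (inverse x))\<^sup>2)\<close> equals
  \<open>sqrt (1 + (norm x)\<^sup>2)\<close>. The estimate needs that it is at least 1.\<close>

lemma chordal_dist_sphere_inverse_le:
  "chordal_dist (sphere_inverse x) (sphere_inverse y) \<le> norm (x - y)"
proof -
  have s: "1 \<le> norm x * sqrt (1 + (norm (inverse x))\<^sup>2)" if "x \<noteq> 0" for x :: complex
  proof -
    have "norm (inverse x) \<le> sqrt (1 + (norm (inverse x))\<^sup>2)" by (rule real_le_rsqrt) simp
    then have "norm x * norm (inverse x) \<le> norm x * sqrt (1 + (norm (inverse x))\<^sup>2)"
      by (intro mult_left_mono) auto
    then show ?thesis using that by (simp add: norm_inverse)
  qed
  have pos: "sqrt (1 + (norm u)\<^sup>2) > 0" for u :: complex by (simp add: add_pos_nonneg)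
  consider "x = 0" "y = 0" | "x = 0" "y \<noteq> 0" | "x \<noteq> 0" "y = 0" | "x \<noteq> 0" "y \<noteq> 0" by blast
  then show ?thesis
  proof cases
    case 4
    have "norm (inverse x - inverse y) = norm (x - y) / (norm x * norm y)"
      using 4 by (simp add: inverse_diff_inverse norm_mult norm_inverse divide_inverse norm_minus_commute mult_ac)
    moreover have "1 * 1 \<le> (norm x * sqrt (1 + (norm (inverse x))\<^sup>2)) * (norm y * sqrt (1 + (norm (inverse y))\<^sup>2))"
      using s 4 by (intro mult_mono) auto
    then have "norm (x - y) * 1 \<le> norm (x - y) * ((norm x * norm y) * (sqrt (1 + (norm (inverse x))\<^sup>2) * sqrt (1 + (norm (inverse y))\<^sup>2)))"
      by (intro mult_left_mono) (auto simp: mult_ac)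
    ultimately show ?thesis
      using 4 pos[of "inverse x"] pos[of "inverse y"]
      by (simp add: pos_divide_le_eq mult_ac del: norm_inverse)
  qed (use s pos in \<open>auto simp: pos_divide_le_eq simp del: norm_inverse\<close>)
qed

lemma conv_chart_imp_spherical:
  assumes F: "\<And>n. F n nicely_meromorphic_on UNIV" and c: "conv_chart F L U" and U: "open U" and e: "e > 0"
  shows "\<forall>\<^sub>F n in sequentially. \<forall>w\<in>U. spherical_dist (to_sphere (F n) w) (L w) < e"
proof -
  \<comment> \<open>The chord that belongs to the arc \<open>e\<close>; the cap
    \<open>pi / 2\<close> stays in the range where \<open>arcsin\<close> inverts
    \<open>sin\<close>.\<close>
  define e' where "e' = sin (min e (pi / 2))"
  have "min e (pi / 2) < pi" using pi_gt_zero by linarith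
  then have e': "e' > 0" "e' \<le> 1" using e by (auto simp: e'_def intro!: sin_gt_zero)
  have arc: "spherical_dist p q < e" if "chordal_dist p q < e'" for p q
  proof -
    have "arcsin (chordal_dist p q) < arcsin e'"
      using that e' chordal_dist_nonneg[of p q] by (intro arcsin_less_arcsin) auto
    also have "arcsin e' = min e (pi / 2)"
      unfolding e'_def using e pi_gt_zero by (intro arcsin_sin) linarith+
    finally show ?thesis by (simp add: spherical_dist_def)
  qed
  from c have "\<forall>\<^sub>F n in sequentially. \<forall>w\<in>U. chordal_dist (to_sphere (F n) w) (L w) < e'"
    unfolding conv_chart_def
  proof (elim disjE exE conjE)
    fix h assume h: "disc_conv F U h" and L: "\<forall>w\<in>U. L w = Finite (h w)"
    have "\<forall>\<^sub>F n in sequentially. F n holomorphic_on U" "\<forall>\<^sub>F n in sequentially. \<forall>w\<in>U. dist (F n w) (h w) < e'"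
      using h e' by (auto simp: disc_conv_def uniform_limit_iff)
    then show ?thesis
    proof eventually_elim
      case (elim n)
      show ?case
      proof
        fix w assume w: "w \<in> U"
        then have "to_sphere (F n) w = Finite (F n w)"
          using not_is_pole_holomorphic[OF U w elim(1)] by (simp add: to_sphere_def)
        then show "chordal_dist (to_sphere (F n) w) (L w) < e'"
          using L w elim(2) chordal_dist_Finite_le[of "F n w" "h w"] by (force simp: dist_norm simp del: chordal_dist.simps)
      qed
    qed
  next
    fix k assume k: "disc_conv_inverse F U k" and L: "\<forall>w\<in>U. L w = sphere_inverse (k w)"
    have "\<forall>\<^sub>F n in sequentially. \<forall>w\<in>U. F n w = 0 \<longrightarrow> is_pole (F n) w"
      "\<forall>\<^sub>F n in sequentially. \<forall>w\<in>U. dist (inverse (F n w)) (k w) < e'"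
      using k e' by (auto simp: disc_conv_def disc_conv_inverse_def uniform_limit_iff)
    then show ?thesis
    proof eventually_elim
      case (elim n)
      show ?case
      proof
        fix w assume w: "w \<in> U"
        have "to_sphere (F n) w = sphere_inverse (inverse (F n w))"
          using elim(1) w nicely_meromorphic_nonzero_not_pole[OF F[of n], of w]
          by (cases "F n w = 0") (auto simp: to_sphere_def)
        then show "chordal_dist (to_sphere (F n) w) (L w) < e'"
          using L w elim(2) chordal_dist_sphere_inverse_le[of "inverse (F n w)" "k w"]
          by (force simp: dist_norm simp del: chordal_dist.simps)
      qed
    qed
  qed
  then show ?thesis by eventually_elim (use arc in blast)
qed

section \<open>Affine substitutions\<close>

lemma nicely_meromorphic_affine:
  fixes c d m :: complex
  assumes F: "F nicely_meromorphic_on UNIV" and c: "c \<noteq> 0"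
  shows "(\<lambda>z. F (m + c * z)) nicely_meromorphic_on UNIV"
    and "is_pole (\<lambda>z. F (m + c * z)) z \<longleftrightarrow> is_pole F (m + c * z)"
proof -
  \<comment> \<open>An affine bijection carries punctured neighbourhoods to punctured
    neighbourhoods; this identity of filters transfers both poles and limits.\<close>
  have map: "filtermap (\<lambda>z. m + c * z) (at z) = at (m + c * z)" for z
  proof (rule filtermap_fun_inverse[where g = "\<lambda>y. (y - m) / c"])
    have "((\<lambda>y. (y - m) / c) \<longlongrightarrow> (m + c * z - m) / c) (at (m + c * z))"
      using c by (intro tendsto_intros)
    then show "filterlim (\<lambda>y. (y - m) / c) (at z) (at (m + c * z))"
      using c by (auto simp: filterlim_at eventually_at_filter field_simps)
    have "((\<lambda>z. m + c * z) \<longlongrightarrow> m + c * z) (at z)" by (intro tendsto_intros)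
    then show "filterlim (\<lambda>z. m + c * z) (at (m + c * z)) (at z)"
      using c by (auto simp: filterlim_at eventually_at_filter)
  qed (use c in auto)
  show pole: "is_pole (\<lambda>z. F (m + c * z)) z \<longleftrightarrow> is_pole F (m + c * z)" for z
    using is_pole_compose_iff[OF map, of F z] by (simp add: o_def)
  have "(\<lambda>z. F (m + c * z)) meromorphic_on UNIV"
    by (rule meromorphic_on_compose[of F UNIV])
      (use F in \<open>auto simp: nicely_meromorphic_on_def intro!: analytic_intros\<close>)
  moreover have "is_pole (\<lambda>z. F (m + c * z)) z \<and> F (m + c * z) = 0 \<or> (\<lambda>z. F (m + c * z)) \<midarrow>z\<rightarrow> F (m + c * z)" for z
    using F filterlim_filtermap[of F "nhds (F (m + c * z))" "\<lambda>z. m + c * z" "at z"]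
    unfolding pole nicely_meromorphic_on_def map by blast
  ultimately show "(\<lambda>z. F (m + c * z)) nicely_meromorphic_on UNIV"
    by (simp add: nicely_meromorphic_on_def)
qed

section \<open>The rescaling lemma of Zalcman and Pang\<close>

lemma nicely_meromorphic_has_deriv:
  assumes "F nicely_meromorphic_on UNIV" "\<not> is_pole F z"
  shows "F analytic_on {z}" "(F has_field_derivative deriv F z) (at z)"
    "isCont F z" "isCont (deriv F) z"
proof -
  show an: "F analytic_on {z}" using nicely_meromorphic_on_imp_analytic_at assms by blast
  then show "(F has_field_derivative deriv F z) (at z)"
    by (simp add: analytic_on_imp_differentiable_at DERIV_deriv_iff_field_differentiable)
  show "isCont F z" "isCont (deriv F) z"
    using an analytic_deriv analytic_at_imp_isCont by blast+
qed

lemma deriv_inverse_norm: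
  assumes "F nicely_meromorphic_on UNIV" "F z \<noteq> 0"
  shows "deriv (\<lambda>u. inverse (F u)) z = - (deriv F z / (F z)\<^sup>2)"
proof -
  have "\<not> is_pole F z" using nicely_meromorphic_nonzero_not_pole assms by blast
  then have "(F has_field_derivative deriv F z) (at z)"
    using nicely_meromorphic_has_deriv assms by blast
  then have "((\<lambda>u. inverse (F u)) has_field_derivative - (inverse (F z) * deriv F z * inverse (F z))) (at z)"
    using assms(2) by (rule DERIV_inverse')
  then show ?thesis by (simp add: DERIV_imp_deriv power2_eq_square divide_inverse)
qed

lemma eventually_at_ball:
  assumes "\<forall>\<^sub>F u in nhds z. P u"
  obtains d where "d > 0" "\<And>u. u \<in> ball z d \<Longrightarrow> P u"
  using assms unfolding eventually_nhds_metric by (auto simp: dist_commute)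

text \<open>Divided by \<open>\<rho>\<^sup>2 + (norm (F z))\<^sup>2\<close>, the left side is the
  spherical derivative at 0 of \<open>F (z + \<rho> * w) / \<rho>\<close> as a function of
  \<open>w\<close>. Away from zeros, and also near poles, \<open>deriv F\<close> is locally at most
  a constant times \<open>(norm F)\<^sup>2\<close>, and a small \<open>\<rho>\<close> beats the
  constant; at a zero the bound \<open>A\<close> persists nearby with slack 1.\<close>

lemma rescaled_deriv_small:
  fixes F :: "complex \<Rightarrow> complex" and A :: real
  assumes F: "F nicely_meromorphic_on UNIV" and A: "A \<ge> 0"
    and zeros: "\<And>z. \<not> is_pole F z \<Longrightarrow> F z = 0 \<Longrightarrow> norm (deriv F z) \<le> A"
  shows "\<exists>d>0. \<forall>z\<in>ball z0 d. \<forall>\<rho>. 0 < \<rho> \<and> \<rho> \<le> d \<and> \<not> is_pole F z \<longrightarrow>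
    norm (deriv F z) * \<rho>\<^sup>2 \<le> (A + 1) * (\<rho>\<^sup>2 + (norm (F z))\<^sup>2)"
proof -
  have finish: ?thesis if ev: "\<forall>\<^sub>F z in nhds z0. \<not> is_pole F z \<longrightarrow> norm (deriv F z) \<le> B * (norm (F z))\<^sup>2"
    and B: "B > 0" for B
  proof -
    obtain d1 where d1: "d1 > 0"
      "\<And>z. z \<in> ball z0 d1 \<Longrightarrow> \<not> is_pole F z \<longrightarrow> norm (deriv F z) \<le> B * (norm (F z))\<^sup>2"
      using eventually_at_ball[OF ev] by blast
    \<comment> \<open>Gives \<open>B * \<rho>\<^sup>2 \<le> 1\<close>, because
      \<open>B \<le> (B + 1)\<^sup>2\<close>.\<close>
    define d where "d = min d1 (1 / (B + 1))"
    have d: "d > 0" "d \<le> d1" using d1 B by (auto simp: d_def)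
    have "norm (deriv F z) * \<rho>\<^sup>2 \<le> (A + 1) * (\<rho>\<^sup>2 + (norm (F z))\<^sup>2)"
      if z: "z \<in> ball z0 d" "\<not> is_pole F z" and \<rho>: "0 < \<rho>" "\<rho> \<le> d" for z \<rho>
    proof -
      have "\<rho> \<le> 1 / (B + 1)" using \<rho> by (simp add: d_def)
      then have "\<rho> * (B + 1) \<le> 1" using B by (simp add: field_simps)
      then have "(\<rho> * (B + 1))\<^sup>2 \<le> 1" using \<rho> B by (simp add: power_le_one)
      moreover have "B \<le> (B + 1)\<^sup>2" using B by (simp add: power2_eq_square algebra_simps)
      then have "B * \<rho>\<^sup>2 \<le> (B + 1)\<^sup>2 * \<rho>\<^sup>2" by (rule mult_right_mono) simp
      ultimately have B\<rho>: "B * \<rho>\<^sup>2 \<le> 1" by (simp add: power_mult_distrib mult.commute)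
      have "norm (deriv F z) * \<rho>\<^sup>2 \<le> (B * (norm (F z))\<^sup>2) * \<rho>\<^sup>2"
        using d1(2)[of z] z d by (intro mult_right_mono) auto
      also have "\<dots> = (B * \<rho>\<^sup>2) * (norm (F z))\<^sup>2" by simp
      also have "\<dots> \<le> 1 * (norm (F z))\<^sup>2" using B\<rho> by (rule mult_right_mono) simp
      also have "\<dots> \<le> (A + 1) * (\<rho>\<^sup>2 + (norm (F z))\<^sup>2)" using A by (intro mult_mono) auto
      finally show ?thesis .
    qed
    then show ?thesis using d by blast
  qed
  consider "is_pole F z0" | "\<not> is_pole F z0" "F z0 = 0" | "\<not> is_pole F z0" "F z0 \<noteq> 0" by blast
  then show ?thesis
  proof cases
    case 1
    define k where "k = (\<lambda>z. inverse (F z))"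
    have kn: "k nicely_meromorphic_on UNIV" unfolding k_def by (rule nicely_meromorphic_on_inverse[OF F])
    have "\<not> is_pole k z0"
    proof
      assume "is_pole k z0"
      then have "isolated_zero F z0" by (simp add: k_def is_pole_inverse_iff)
      then show False using 1 pole_is_not_zero by auto
    qed
    then have "isCont (deriv k) z0" using nicely_meromorphic_has_deriv(4)[OF kn] by blast
    then have "((\<lambda>z. norm (deriv k z)) \<longlongrightarrow> norm (deriv k z0)) (at z0)"
      unfolding isCont_def by (rule tendsto_norm)
    then have "\<forall>\<^sub>F z in at z0. norm (deriv k z) < norm (deriv k z0) + 1"
      by (rule order_tendstoD) simp
    moreover have "\<forall>\<^sub>F z in at z0. F z \<noteq> 0" using 1 by (rule non_zero_neighbour_pole)
    ultimately have "\<forall>\<^sub>F z in at z0. \<not> is_pole F z \<longrightarrow>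
        norm (deriv F z) \<le> (norm (deriv k z0) + 1) * (norm (F z))\<^sup>2"
    proof eventually_elim
      case (elim z)
      have "norm (deriv k z) = norm (deriv F z) / (norm (F z))\<^sup>2"
        unfolding k_def deriv_inverse_norm[OF F elim(2)] by (simp add: norm_divide norm_power)
      then have "norm (deriv F z) = norm (deriv k z) * (norm (F z))\<^sup>2" using elim by simp
      then show ?case using elim by (simp add: mult_right_mono)
    qed
    then show ?thesis using 1 by (intro finish[of "norm (deriv k z0) + 1"])
        (auto simp: eventually_nhds_conv_at add_nonneg_pos)
  next
    case 2
    have "isCont (deriv F) z0" using nicely_meromorphic_has_deriv(4)[OF F 2(1)] .
    then have "((\<lambda>z. norm (deriv F z)) \<longlongrightarrow> norm (deriv F z0)) (nhds z0)"
      unfolding continuous_within tendsto_at_iff_tendsto_nhds by (rule tendsto_norm)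
    then have "\<forall>\<^sub>F z in nhds z0. norm (deriv F z) < A + 1"
      by (rule order_tendstoD) (use zeros[OF 2] in simp)
    then obtain d where d: "d > 0" "\<And>z. z \<in> ball z0 d \<Longrightarrow> norm (deriv F z) < A + 1"
      using eventually_at_ball by blast
    have "norm (deriv F z) * \<rho>\<^sup>2 \<le> (A + 1) * (\<rho>\<^sup>2 + (norm (F z))\<^sup>2)" if "z \<in> ball z0 d" for z \<rho>
      using d(2)[OF that] A by (intro mult_mono) auto
    then show ?thesis using d(1) by blast
  next
    case 3
    have c: "isCont (deriv F) z0" "isCont F z0" using nicely_meromorphic_has_deriv[OF F 3(1)] by auto
    have "((\<lambda>z. norm (deriv F z) / (norm (F z))\<^sup>2) \<longlongrightarrow> norm (deriv F z0) / (norm (F z0))\<^sup>2) (nhds z0)"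
      using c 3 unfolding continuous_within tendsto_at_iff_tendsto_nhds by (intro tendsto_intros) auto
    then have "\<forall>\<^sub>F z in nhds z0. norm (deriv F z) / (norm (F z))\<^sup>2 < norm (deriv F z0) / (norm (F z0))\<^sup>2 + 1"
      by (rule order_tendstoD) simp
    moreover have "(F \<longlongrightarrow> F z0) (nhds z0)" using c(2) unfolding continuous_within tendsto_at_iff_tendsto_nhds .
    then have "\<forall>\<^sub>F z in nhds z0. F z \<noteq> 0" using 3(2) by (rule tendsto_imp_eventually_ne)
    ultimately have "\<forall>\<^sub>F z in nhds z0. \<not> is_pole F z \<longrightarrow>
        norm (deriv F z) \<le> (norm (deriv F z0) / (norm (F z0))\<^sup>2 + 1) * (norm (F z))\<^sup>2"
      by eventually_elim (simp add: pos_divide_less_eq)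
    then show ?thesis by (intro finish) (auto simp: add_nonneg_pos)
  qed
qed

text \<open>
  The parameter \<open>t\<close> runs through powers of 1/2 only: the smallest one that still admits a point above the
  threshold loses a factor 4, but needs no continuity in \<open>t\<close>.
\<close>

lemma rescaling_point:
  fixes F :: "complex \<Rightarrow> complex" and A :: real and m :: nat
  assumes F: "F nicely_meromorphic_on UNIV" and A: "A \<ge> 0"
    and zeros: "\<And>z. \<not> is_pole F z \<Longrightarrow> F z = 0 \<Longrightarrow> norm (deriv F z) \<le> A"
    and w: "\<not> is_pole F w" "norm (deriv F w) > (A + 1) * 4 ^ m * (1 + (norm (F w))\<^sup>2)"
  obtains z \<rho> t where "0 < t" "t \<le> 1 / 2 ^ m" "0 < \<rho>" "\<rho> \<le> t" "\<not> is_pole F z"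
    "(A + 1) * (\<rho>\<^sup>2 + (norm (F z))\<^sup>2) < norm (deriv F z) * \<rho>\<^sup>2"
    "\<And>\<xi> R. \<not> is_pole F \<xi> \<Longrightarrow> norm (\<xi> - z) \<le> \<rho> * R \<Longrightarrow> 0 \<le> R \<Longrightarrow> t * R \<le> 1 / 2 \<Longrightarrow>
      norm (deriv F \<xi>) * \<rho>\<^sup>2 \<le> 16 * (A + 1) * (\<rho>\<^sup>2 + (norm (F \<xi>))\<^sup>2)"
proof -
  define P where "P z \<sigma> \<longleftrightarrow> \<not> is_pole F z \<and> (A + 1) * (\<sigma>\<^sup>2 + (norm (F z))\<^sup>2) < norm (deriv F z) * \<sigma>\<^sup>2" for z \<sigma>
  \<comment> \<open>The weight \<open>1 - dist w z\<close> in the scale vanishes on the boundary of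
    the disc and so keeps a neighbourhood of the chosen point inside.\<close>
  define Q where "Q j \<longleftrightarrow> (\<exists>z\<in>ball w 1. P z ((1 - dist w z) / 2 ^ j))" for j :: nat
  \<comment> \<open>If \<open>Q\<close> held for arbitrarily large j, the scales would tend to 0
    while the points accumulate at some \<open>l\<close>, against
    \<open>rescaled_deriv_small\<close>. So a largest j exists.\<close>
  have "\<exists>N. \<forall>j\<ge>N. \<not> Q j"
  proof (rule ccontr)
    assume "\<not> ?thesis"
    then have "\<forall>N. \<exists>z j. j \<ge> N \<and> z \<in> ball w 1 \<and> P z ((1 - dist w z) / 2 ^ j)" unfolding Q_def by blast
    then obtain x j where xj: "\<And>N. j N \<ge> N" "\<And>N. x N \<in> ball w 1" "\<And>N. P (x N) ((1 - dist w (x N)) / 2 ^ j N)"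
      by metis
    have "x N \<in> cball w 1" for N using xj(2)[of N] by simp
    then obtain l r where lr: "strict_mono r" "(x \<circ> r) \<longlonglongrightarrow> l"
      using compact_cball[of w 1, unfolded compact_def] by blast
    obtain d where d: "d > 0" "\<And>z \<rho>. z \<in> ball l d \<Longrightarrow> 0 < \<rho> \<Longrightarrow> \<rho> \<le> d \<Longrightarrow> \<not> P z \<rho>"
      using rescaled_deriv_small[OF F A zeros, of l] unfolding P_def by (metis not_le)
    have "\<forall>\<^sub>F n in sequentially. dist ((x \<circ> r) n) l < d" using lr(2) d(1) by (rule tendstoD)
    moreover have "(\<lambda>n. (1 / 2) ^ n :: real) \<longlonglongrightarrow> 0" by (rule LIMSEQ_power_zero) simp
    then have "\<forall>\<^sub>F n in sequentially. (1 / 2) ^ n < d" using d(1) by (rule order_tendstoD)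
    ultimately have "\<forall>\<^sub>F n in sequentially. dist ((x \<circ> r) n) l < d \<and> (1 / 2) ^ n < d" by (rule eventually_conj)
    then obtain n where n: "dist (x (r n)) l < d" "(1 / 2) ^ n < d"
      unfolding eventually_sequentially by auto
    define \<sigma> where "\<sigma> = (1 - dist w (x (r n))) / 2 ^ j (r n)"
    have \<sigma>0: "\<sigma> > 0" using xj(2)[of "r n"] by (simp add: \<sigma>_def)
    have "\<sigma> \<le> 1 / 2 ^ j (r n)" unfolding \<sigma>_def by (intro divide_right_mono) auto
    also have "\<dots> = (1 / 2) ^ j (r n)" by (simp add: power_divide)
    also have "\<dots> \<le> (1 / 2) ^ n"
      using xj(1)[of "r n"] seq_suble[OF lr(1), of n] by (intro power_decreasing) auto
    finally have "\<sigma> \<le> d" using n(2) by simp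
    moreover have "x (r n) \<in> ball l d" using n(1) by (simp add: dist_commute)
    ultimately show False using d(2) \<sigma>0 xj(3)[of "r n"] by (simp add: \<sigma>_def)
  qed
  then obtain N where N: "\<And>j. j \<ge> N \<Longrightarrow> \<not> Q j" by blast
  \<comment> \<open>The witness is \<open>w\<close> itself: its weight is 1, its scale
    \<open>1 / 2 ^ m\<close>, and the factor \<open>4 ^ m\<close> in the hypothesis is the square of
    \<open>2 ^ m\<close>.\<close>
  have "Q m"
  proof -
    have pos: "(0::real) < 4 ^ m" by simp
    have "(A + 1) * ((1 / 2 ^ m)\<^sup>2 + (norm (F w))\<^sup>2) \<le> (A + 1) * (1 + (norm (F w))\<^sup>2)"
      using A by (intro mult_left_mono add_right_mono power_le_one) (auto simp: field_simps)
    also have "\<dots> < norm (deriv F w) / 4 ^ m" using w(2) pos by (simp add: pos_less_divide_eq mult_ac)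
    also have "\<dots> = norm (deriv F w) * (1 / 2 ^ m)\<^sup>2"
      by (simp add: power_divide power_mult[symmetric] power_mult mult.commute[of m])
    finally show ?thesis unfolding Q_def P_def using w(1) by (intro bexI[of _ w]) auto
  qed
  define j where "j = (GREATEST j. Q j)"
  have bnd: "\<And>i. Q i \<Longrightarrow> i \<le> N" using N by (meson nle_le)
  have Qj: "Q j" unfolding j_def using GreatestI_nat[of Q m N] \<open>Q m\<close> bnd by blast
  have jm: "m \<le> j" unfolding j_def using Greatest_le_nat[of Q m N] \<open>Q m\<close> bnd by blast
  have nQ: "\<not> Q (Suc j)" using Greatest_le_nat[of Q "Suc j" N] bnd unfolding j_def by (metis not_less_eq_eq le_refl)
  obtain z where z: "z \<in> ball w 1" "P z ((1 - dist w z) / 2 ^ j)" using Qj unfolding Q_def by blast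
  define t where "t = 1 / (2::real) ^ j"
  define \<rho> where "\<rho> = (1 - dist w z) / 2 ^ j"
  have t: "t > 0" "t \<le> 1 / 2 ^ m" using jm by (auto simp: t_def intro!: divide_left_mono power_increasing)
  have \<rho>t: "\<rho> = (1 - dist w z) * t" by (simp add: \<rho>_def t_def)
  have \<rho>: "\<rho> > 0" "\<rho> \<le> t" using z(1) by (auto simp: \<rho>_def t_def intro!: divide_right_mono)
  show ?thesis
  proof (rule that[OF t \<rho>])
    show "\<not> is_pole F z" "(A + 1) * (\<rho>\<^sup>2 + (norm (F z))\<^sup>2) < norm (deriv F z) * \<rho>\<^sup>2"
      using z(2) by (auto simp: P_def \<rho>_def)
    fix \<xi> R assume \<xi>: "\<not> is_pole F \<xi>" "norm (\<xi> - z) \<le> \<rho> * R" and R: "0 \<le> R" "t * R \<le> 1 / 2"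
    define \<sigma> where "\<sigma> = (1 - dist w \<xi>) / 2 ^ Suc j"
    have "dist w \<xi> \<le> dist w z + \<rho> * R"
      using dist_triangle[of w \<xi> z] \<xi>(2) by (simp add: dist_norm norm_minus_commute)
    moreover have "\<rho> * R = (1 - dist w z) * (t * R)" by (simp add: \<rho>t)
    moreover have "(1 - dist w z) * (t * R) \<le> (1 - dist w z) * (1 / 2)"
      using R z(1) by (intro mult_left_mono) auto
    ultimately have ge: "(1 - dist w z) / 2 \<le> 1 - dist w \<xi>" by simp
    then have \<xi>b: "\<xi> \<in> ball w 1" using z(1) by simp
    \<comment> \<open>One factor 2 is the loss in the weight, the other the passage from level j to
      \<open>Suc j\<close>; squared, they give 16.\<close>
    have "\<rho> / 4 = (1 - dist w z) / 2 * t / 2" by (simp add: \<rho>t)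
    also have "\<dots> \<le> (1 - dist w \<xi>) * t / 2" using ge t by (intro divide_right_mono mult_right_mono) auto
    also have "\<dots> = \<sigma>" by (simp add: \<sigma>_def t_def)
    finally have \<sigma>: "\<rho> / 4 \<le> \<sigma>" .
    have "\<not> P \<xi> \<sigma>" using nQ \<xi>b unfolding Q_def \<sigma>_def by blast
    then have le: "norm (deriv F \<xi>) * \<sigma>\<^sup>2 \<le> (A + 1) * (\<sigma>\<^sup>2 + (norm (F \<xi>))\<^sup>2)" using \<xi>(1) by (simp add: P_def)
    have \<sigma>0: "\<sigma> > 0" using \<sigma> \<rho> by linarith
    have sq: "\<rho>\<^sup>2 \<le> 16 * \<sigma>\<^sup>2" using power_mono[of \<rho> "4 * \<sigma>" 2] \<sigma> \<rho> by (simp add: power_mult_distrib)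
    have "norm (deriv F \<xi>) \<le> (A + 1) * (1 + (norm (F \<xi>))\<^sup>2 / \<sigma>\<^sup>2)"
      using le \<sigma>0 by (simp add: field_simps)
    then have "norm (deriv F \<xi>) * \<rho>\<^sup>2 \<le> (A + 1) * (1 + (norm (F \<xi>))\<^sup>2 / \<sigma>\<^sup>2) * \<rho>\<^sup>2"
      by (rule mult_right_mono) simp
    also have "\<dots> = (A + 1) * (\<rho>\<^sup>2 + (norm (F \<xi>))\<^sup>2 * (\<rho>\<^sup>2 / \<sigma>\<^sup>2))" by (simp add: algebra_simps)
    also have "\<dots> \<le> (A + 1) * (16 * \<rho>\<^sup>2 + (norm (F \<xi>))\<^sup>2 * 16)"
      using A sq \<sigma>0 by (intro mult_left_mono add_mono) (auto simp: divide_le_eq)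
    also have "\<dots> = 16 * (A + 1) * (\<rho>\<^sup>2 + (norm (F \<xi>))\<^sup>2)" by (simp add: algebra_simps)
    finally show "norm (deriv F \<xi>) * \<rho>\<^sup>2 \<le> 16 * (A + 1) * (\<rho>\<^sup>2 + (norm (F \<xi>))\<^sup>2)" .
  qed
qed

lemma rescaled_deriv:
  fixes c m :: complex
  assumes F: "F nicely_meromorphic_on UNIV" and c: "c \<noteq> 0"
  shows "(\<lambda>z. inverse c * F (m + c * z)) nicely_meromorphic_on UNIV"
    and "is_pole (\<lambda>z. inverse c * F (m + c * z)) z \<longleftrightarrow> is_pole F (m + c * z)"
    and "\<not> is_pole F (m + c * z) \<Longrightarrow> deriv (\<lambda>z. inverse c * F (m + c * z)) z = deriv F (m + c * z)"
proof -
  show "(\<lambda>z. inverse c * F (m + c * z)) nicely_meromorphic_on UNIV"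
    by (intro nicely_meromorphic_on_cmult_left nicely_meromorphic_affine F c)
  show "is_pole (\<lambda>z. inverse c * F (m + c * z)) z \<longleftrightarrow> is_pole F (m + c * z)"
    using nicely_meromorphic_affine(2)[OF F c] c by simp
  assume "\<not> is_pole F (m + c * z)"
  then have d: "(F has_field_derivative deriv F (m + c * z)) (at (m + c * z))"
    by (rule nicely_meromorphic_has_deriv[OF F])
  have "((\<lambda>z. m + c * z) has_field_derivative c) (at z)" by (auto intro!: derivative_eq_intros)
  then have "((\<lambda>z. F (m + c * z)) has_field_derivative deriv F (m + c * z) * c) (at z)"
    by (rule DERIV_chain2[where f = F and g = "\<lambda>z. m + c * z", OF d])
  then have "((\<lambda>z. inverse c * F (m + c * z)) has_field_derivative inverse c * (deriv F (m + c * z) * c)) (at z)"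
    by (rule DERIV_cmult)
  then show "deriv (\<lambda>z. inverse c * F (m + c * z)) z = deriv F (m + c * z)"
    using c by (simp add: DERIV_imp_deriv)
qed

text \<open>\<open>g n\<close> has the derivative of \<open>F\<close> at the corresponding point,
  and the inequalities of \<open>rescaling_point\<close>, divided by the square of
  \<open>\<rho> n\<close>, are bounds on its spherical derivative. The thresholds
  \<open>4 ^ m\<close> drive the scales to 0.\<close>

theorem Pang_Zalcman:
  fixes F :: "complex \<Rightarrow> complex" and A :: real
  assumes F: "F nicely_meromorphic_on UNIV" and A: "A \<ge> 0"
    and zeros: "\<And>z. \<not> is_pole F z \<Longrightarrow> F z = 0 \<Longrightarrow> norm (deriv F z) \<le> A"
    and unb: "\<And>C. \<not> sph_deriv_le F C UNIV"
  obtains p :: "nat \<Rightarrow> complex" and \<rho> :: "nat \<Rightarrow> real" and g :: "nat \<Rightarrow> complex \<Rightarrow> complex" where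
    "\<And>n. \<rho> n > 0" "\<rho> \<longlonglongrightarrow> 0"
    "\<And>n. g n = (\<lambda>z. inverse (of_real (\<rho> n)) * F (p n + of_real (\<rho> n) * z))"
    "\<And>n. \<not> is_pole (g n) 0" "\<And>n. norm (deriv (g n) 0) > (A + 1) * (1 + (norm (g n 0))\<^sup>2)"
    "\<And>R. \<forall>\<^sub>F n in sequentially. sph_deriv_le (g n) (16 * (A + 1)) (ball 0 R)"
proof -
  have "\<exists>w. \<not> is_pole F w \<and> norm (deriv F w) > (A + 1) * 4 ^ m * (1 + (norm (F w))\<^sup>2)" for m :: nat
    using unb[of "(A + 1) * 4 ^ m"] unfolding sph_deriv_le_def by (auto simp: not_le)
  then have "\<exists>z \<rho> t. 0 < t \<and> t \<le> 1 / 2 ^ m \<and> 0 < \<rho> \<and> \<rho> \<le> t \<and> \<not> is_pole F z \<and>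
    (A + 1) * (\<rho>\<^sup>2 + (norm (F z))\<^sup>2) < norm (deriv F z) * \<rho>\<^sup>2 \<and>
    (\<forall>\<xi> R. \<not> is_pole F \<xi> \<longrightarrow> norm (\<xi> - z) \<le> \<rho> * R \<longrightarrow> 0 \<le> R \<longrightarrow> t * R \<le> 1 / 2 \<longrightarrow>
      norm (deriv F \<xi>) * \<rho>\<^sup>2 \<le> 16 * (A + 1) * (\<rho>\<^sup>2 + (norm (F \<xi>))\<^sup>2))" for m :: nat
    using rescaling_point[OF F A zeros] by metis
  then obtain p \<rho> t where pt: "\<And>n. 0 < t n" "\<And>n. t n \<le> 1 / 2 ^ n" "\<And>n. 0 < \<rho> n" "\<And>n. \<rho> n \<le> t n"
    "\<And>n. \<not> is_pole F (p n)"
    "\<And>n. (A + 1) * ((\<rho> n)\<^sup>2 + (norm (F (p n)))\<^sup>2) < norm (deriv F (p n)) * (\<rho> n)\<^sup>2"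
    "\<And>n \<xi> R. \<not> is_pole F \<xi> \<Longrightarrow> norm (\<xi> - p n) \<le> \<rho> n * R \<Longrightarrow> 0 \<le> R \<Longrightarrow> t n * R \<le> 1 / 2 \<Longrightarrow>
      norm (deriv F \<xi>) * (\<rho> n)\<^sup>2 \<le> 16 * (A + 1) * ((\<rho> n)\<^sup>2 + (norm (F \<xi>))\<^sup>2)"
    by metis
  have half: "(\<lambda>n. 1 / 2 ^ n :: real) \<longlonglongrightarrow> 0"
    using LIMSEQ_power_zero[of "1 / 2 :: real"] by (simp add: power_divide)
  have t0: "t \<longlonglongrightarrow> 0"
    by (rule tendsto_sandwich[OF _ _ tendsto_const half]) (auto intro!: always_eventually less_imp_le pt)
  have \<rho>0: "\<rho> \<longlonglongrightarrow> 0"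
    by (rule tendsto_sandwich[OF _ _ tendsto_const t0]) (auto intro!: always_eventually less_imp_le[OF pt(3)] pt(4))
  define g where "g = (\<lambda>n z. inverse (of_real (\<rho> n)) * F (p n + of_real (\<rho> n) * z))"
  have \<rho>nz: "complex_of_real (\<rho> n) \<noteq> 0" for n using pt(3)[of n] by simp
  have pole: "is_pole (g n) z \<longleftrightarrow> is_pole F (p n + of_real (\<rho> n) * z)" for n z
    unfolding g_def by (rule rescaled_deriv(2)[OF F \<rho>nz])
  have der: "deriv (g n) z = deriv F (p n + of_real (\<rho> n) * z)" if "\<not> is_pole (g n) z" for n z
    using rescaled_deriv(3)[OF F \<rho>nz, of "p n" n z] that pole[of n z] unfolding g_def by blast
  have ng: "(\<rho> n)\<^sup>2 * (norm (g n z))\<^sup>2 = (norm (F (p n + of_real (\<rho> n) * z)))\<^sup>2" for n z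
    using pt(3)[of n] by (simp add: g_def norm_mult norm_inverse power_mult_distrib power_inverse)
  show ?thesis
  proof (rule that[of \<rho> g p])
    show "\<not> is_pole (g n) 0" for n using pt(5)[of n] by (simp add: pole)
    then show "norm (deriv (g n) 0) > (A + 1) * (1 + (norm (g n 0))\<^sup>2)" for n
    proof -
      have "(A + 1) * ((\<rho> n)\<^sup>2 + (\<rho> n)\<^sup>2 * (norm (g n 0))\<^sup>2) < norm (deriv (g n) 0) * (\<rho> n)\<^sup>2"
        using pt(6)[of n] ng[of n 0] der[of n 0] \<open>\<not> is_pole (g n) 0\<close> by simp
      then have "((A + 1) * (1 + (norm (g n 0))\<^sup>2)) * (\<rho> n)\<^sup>2 < norm (deriv (g n) 0) * (\<rho> n)\<^sup>2"
        by (simp add: algebra_simps)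
      then show ?thesis using pt(3)[of n] by (simp add: mult_less_cancel_right_pos)
    qed
    show "\<forall>\<^sub>F n in sequentially. sph_deriv_le (g n) (16 * (A + 1)) (ball 0 R)" for R
    proof -
      \<comment> \<open>Radii in \<open>rescaling_point\<close> are admissible up to
        \<open>t * R \<le> 1 / 2\<close>, so every fixed disc is eventually covered.\<close>
      have "(\<lambda>n. t n * \<bar>R\<bar>) \<longlonglongrightarrow> 0 * \<bar>R\<bar>" by (intro tendsto_mult t0 tendsto_const)
      then have "\<forall>\<^sub>F n in sequentially. t n * \<bar>R\<bar> < 1 / 2" by (intro order_tendstoD) auto
      then show ?thesis
      proof eventually_elim
        case (elim n)
        show ?case unfolding sph_deriv_le_def
        proof (intro ballI impI)
          fix z assume z: "z \<in> ball 0 R" "\<not> is_pole (g n) z"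
          define \<xi> where "\<xi> = p n + of_real (\<rho> n) * z"
          have "norm (\<xi> - p n) \<le> \<rho> n * \<bar>R\<bar>"
            using z(1) pt(3)[of n] by (auto simp: \<xi>_def norm_mult intro!: mult_left_mono)
          then have "norm (deriv F \<xi>) * (\<rho> n)\<^sup>2 \<le> 16 * (A + 1) * ((\<rho> n)\<^sup>2 + (norm (F \<xi>))\<^sup>2)"
            using pt(7)[of \<xi> n "\<bar>R\<bar>"] z(2) elim by (simp add: pole \<xi>_def)
          then have "norm (deriv (g n) z) * (\<rho> n)\<^sup>2 \<le> 16 * (A + 1) * ((\<rho> n)\<^sup>2 + (\<rho> n)\<^sup>2 * (norm (g n z))\<^sup>2)"
            using ng[of n z] der[OF z(2)] by (simp add: \<xi>_def)
          then have "norm (deriv (g n) z) * (\<rho> n)\<^sup>2 \<le> (16 * (A + 1) * (1 + (norm (g n z))\<^sup>2)) * (\<rho> n)\<^sup>2"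
            by (simp add: algebra_simps)
          then show "norm (deriv (g n) z) \<le> 16 * (A + 1) * (1 + (norm (g n z))\<^sup>2)"
            using pt(3)[of n] by (simp add: mult_le_cancel_right_pos)
        qed
      qed
    qed
  qed (use pt \<rho>0 in \<open>auto simp: g_def\<close>)
qed

section \<open>Limits of rescaled functions\<close>

text \<open>Cauchy's estimate on circles of radius \<open>s\<close>, half the gap between the two
  discs.\<close>

lemma disc_conv_deriv:
  assumes conv: "disc_conv G (ball z d) h" and r: "r < d"
  shows "uniform_limit (cball z r) (\<lambda>n. deriv (G n)) (deriv h) sequentially"
proof (rule uniform_limitI)
  fix e :: real assume e: "e > 0"
  define s where "s = (d - r) / 2"
  have s: "s > 0" "r + s < d" using r by (auto simp: s_def field_simps)
  have h: "h holomorphic_on ball z d" using conv by (simp add: disc_conv_def)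
  have "e / 2 * s > 0" using e s by simp
  then have "\<forall>\<^sub>F n in sequentially. G n holomorphic_on ball z d"
    "\<forall>\<^sub>F n in sequentially. \<forall>x\<in>ball z d. dist (G n x) (h x) < e / 2 * s"
    using conv unfolding disc_conv_def uniform_limit_iff by blast+
  then show "\<forall>\<^sub>F n in sequentially. \<forall>w\<in>cball z r. dist (deriv (G n) w) (deriv h w) < e"
  proof eventually_elim
    case (elim n)
    show ?case
    proof
      fix w assume w: "w \<in> cball z r"
      have sub: "ball w (2 * s) \<subseteq> ball z d"
      proof
        fix u assume "u \<in> ball w (2 * s)"
        then show "u \<in> ball z d" using w dist_triangle[of z u w] by (simp add: s_def)
      qed
      have wz: "w \<in> ball z d" using w r by simp
      have "norm (deriv (\<lambda>u. G n u - h u) w) \<le> (e / 2 * s) / s"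
      proof (rule Cauchy_deriv_bound[where R = "2 * s"])
        show "(\<lambda>u. G n u - h u) holomorphic_on ball w (2 * s)"
          by (intro holomorphic_intros holomorphic_on_subset[OF elim(1)] holomorphic_on_subset[OF h] sub)
        fix u assume u: "norm (u - w) = s"
        then have "u \<in> ball w (2 * s)" using s by (simp add: dist_norm norm_minus_commute)
        then have "u \<in> ball z d" using sub by blast
        then show "norm (G n u - h u) \<le> e / 2 * s" using elim(2) by (auto simp: dist_norm intro: less_imp_le)
      qed (use s in auto)
      moreover have "deriv (\<lambda>u. G n u - h u) w = deriv (G n) w - deriv h w"
        by (rule deriv_diff) (use elim(1) h wz holomorphic_on_imp_differentiable_at open_ball in blast)+
      ultimately show "dist (deriv (G n) w) (deriv h w) < e" using s e by (simp add: dist_norm)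
    qed
  qed
qed

lemma disc_conv_deriv_disc:
  assumes conv: "disc_conv G (ball z d) h" and r: "r < d"
  shows "disc_conv (\<lambda>n. deriv (G n)) (ball z r) (deriv h)"
proof -
  have sub: "ball z r \<subseteq> ball z d" using r by auto
  have der: "deriv f holomorphic_on ball z r" if "f holomorphic_on ball z d" for f
    using that sub by (intro holomorphic_deriv) (auto intro: holomorphic_on_subset)
  have "uniform_limit (ball z r) (\<lambda>n. deriv (G n)) (deriv h) sequentially"
    by (rule uniform_limit_on_subset[OF disc_conv_deriv[OF conv r]]) auto
  moreover have "\<forall>\<^sub>F n in sequentially. deriv (G n) holomorphic_on ball z r"
    by (rule eventually_mono[of "\<lambda>n. G n holomorphic_on ball z d"])
      (use conv der in \<open>auto simp: disc_conv_def\<close>)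
  ultimately show ?thesis using der[of h] conv by (simp add: disc_conv_def)
qed

lemma disc_conv_pointwise:
  assumes "disc_conv G (ball z d) h" "w \<in> ball z d"
  shows "(\<lambda>n. G n w) \<longlonglongrightarrow> h w" "(\<lambda>n. deriv (G n) w) \<longlonglongrightarrow> deriv h w"
proof -
  show "(\<lambda>n. G n w) \<longlonglongrightarrow> h w"
    using assms tendsto_uniform_limitI[where S = "ball z d" and f = G and l = h] by (simp add: disc_conv_def)
  have "w \<in> cball z (dist z w)" "dist z w < d" using assms(2) by auto
  then show "(\<lambda>n. deriv (G n) w) \<longlonglongrightarrow> deriv h w"
    using tendsto_uniform_limitI[OF disc_conv_deriv[OF assms(1)]] by blast
qed

lemma disc_conv_cong:
  assumes "disc_conv G U h" "\<And>w. w \<in> U \<Longrightarrow> h w = h' w"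
  shows "disc_conv G U h'"
proof -
  have "h holomorphic_on U \<longleftrightarrow> h' holomorphic_on U" by (rule holomorphic_cong) (use assms(2) in auto)
  moreover have "uniform_limit U G h sequentially \<longleftrightarrow> uniform_limit U G h' sequentially"
    by (rule uniform_limit_cong') (use assms(2) in auto)
  ultimately show ?thesis using assms(1) by (simp add: disc_conv_def)
qed

lemma disc_conv_diff_const:
  assumes "disc_conv G U h"
  shows "disc_conv (\<lambda>n w. G n w - c) U (\<lambda>w. h w - c)"
proof -
  have "\<forall>\<^sub>F n in sequentially. (\<lambda>w. G n w - c) holomorphic_on U"
    by (rule eventually_mono[of "\<lambda>n. G n holomorphic_on U"])
      (use assms in \<open>auto simp: disc_conv_def intro!: holomorphic_intros\<close>)
  moreover have "dist (x - c) (y - c) = dist x y" for x y by (simp add: dist_norm)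
  ultimately show ?thesis using assms
    by (auto simp: disc_conv_def uniform_limit_iff intro!: holomorphic_intros)
qed

lemma Hurwitz_disc:
  assumes conv: "disc_conv G (ball z d) h" and d: "d > 0"
    and nz: "\<forall>\<^sub>F n in sequentially. \<forall>w\<in>ball z d. G n w \<noteq> 0" and hz: "h z = 0"
  shows "\<forall>w\<in>ball z d. h w = 0"
proof -
  have ul: "uniform_limit (ball z d) G h sequentially" and h: "h holomorphic_on ball z d"
    using conv by (simp_all add: disc_conv_def)
  have "\<forall>\<^sub>F n in sequentially. G n holomorphic_on ball z d" using conv by (simp add: disc_conv_def)
  with nz have "\<forall>\<^sub>F n in sequentially. G n holomorphic_on ball z d \<and> (\<forall>w\<in>ball z d. G n w \<noteq> 0)"
    by eventually_elim auto
  then obtain N where N: "\<And>n. n \<ge> N \<Longrightarrow> G n holomorphic_on ball z d \<and> (\<forall>w\<in>ball z d. G n w \<noteq> 0)"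
    unfolding eventually_sequentially by blast
  \<comment> \<open>Otherwise Hurwitz's theorem, applied to the tail from \<open>N\<close> on, would
    make \<open>h\<close> zero-free, against \<open>h z = 0\<close>.\<close>
  have "h constant_on ball z d"
  proof (rule ccontr)
    assume nc: "\<not> h constant_on ball z d"
    have "h z \<noteq> 0"
    proof (rule Hurwitz_no_zeros[where S = "ball z d" and g = h and ?z0.0 = z and \<F> = "\<lambda>n. G (n + N)"])
      fix K assume K: "K \<subseteq> ball z d"
      have "\<forall>\<^sub>F n in sequentially. \<forall>x\<in>K. dist (G (n + N) x) (h x) < e" if "e > 0" for e
      proof -
        have "\<forall>\<^sub>F n in sequentially. \<forall>x\<in>ball z d. dist (G n x) (h x) < e"
          using ul that by (simp add: uniform_limit_iff)
        then obtain M where "\<And>n. n \<ge> M \<Longrightarrow> \<forall>x\<in>ball z d. dist (G n x) (h x) < e"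
          unfolding eventually_sequentially by blast
        then show ?thesis using K unfolding eventually_sequentially by (intro exI[of _ M]) auto
      qed
      then show "uniform_limit K (\<lambda>n. G (n + N)) h sequentially" by (simp add: uniform_limit_iff)
    qed (use N h nc d in auto)
    then show False using hz by simp
  qed
  then show ?thesis using hz d unfolding constant_on_def by (metis centre_in_ball)
qed

text \<open>Change of chart at a finite value of the limit: near \<open>z\<close> the norm of
  \<open>k\<close> is bounded below, so inversion preserves uniform convergence and eventually
  \<open>F n\<close> has no poles.\<close>

lemma disc_conv_inverse_finite:
  assumes conv: "disc_conv_inverse F (ball z d) k" and d: "d > 0" and kz: "k z \<noteq> 0"
  shows "\<exists>e>0. e \<le> d \<and> disc_conv F (ball z e) (\<lambda>w. inverse (k w))"
proof -
  have conv': "disc_conv (\<lambda>n w. inverse (F n w)) (ball z d) k" using conv by (simp add: disc_conv_inverse_def)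
  then have k: "k holomorphic_on ball z d" by (simp add: disc_conv_def)
  define c where "c = norm (k z) / 2"
  have c: "c > 0" using kz by (simp add: c_def)
  have "isCont k z" using k d by (simp add: holomorphic_on_imp_analytic_at analytic_at_imp_isCont)
  then have "((\<lambda>w. norm (k w)) \<longlongrightarrow> norm (k z)) (nhds z)"
    unfolding continuous_within tendsto_at_iff_tendsto_nhds by (rule tendsto_norm)
  then have "\<forall>\<^sub>F w in nhds z. norm (k w) > c" by (rule order_tendstoD) (use kz in \<open>simp add: c_def\<close>)
  then obtain e0 where e0: "e0 > 0" "\<And>w. dist w z < e0 \<Longrightarrow> norm (k w) > c"
    unfolding eventually_nhds_metric by blast
  define e where "e = min d e0"
  have e: "e > 0" "e \<le> d" using e0 d by (auto simp: e_def)
  have big: "norm (k w) > c" if "w \<in> ball z e" for w using that e0(2)[of w] by (simp add: e_def dist_commute)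
  have nz: "k w \<noteq> 0" if "w \<in> ball z e" for w using big[OF that] c by auto
  have conv'': "disc_conv (\<lambda>n w. inverse (F n w)) (ball z e) k"
    by (rule disc_conv_subset[OF conv']) (use e in auto)
  then have "uniform_limit (ball z e) (\<lambda>n w. inverse (inverse (F n w))) (inverse \<circ> k) sequentially"
    using big c by (intro uniform_lim_inverse[where b = c]) (auto simp: disc_conv_def intro: less_imp_le)
  then have ul: "uniform_limit (ball z e) F (\<lambda>w. inverse (k w)) sequentially" by (simp add: o_def)
  have "\<forall>\<^sub>F n in sequentially. (\<lambda>w. inverse (F n w)) holomorphic_on ball z e"
    "\<forall>\<^sub>F n in sequentially. \<forall>w\<in>ball z e. dist (inverse (F n w)) (k w) < c"
    using conv'' c by (auto simp: disc_conv_def uniform_limit_iff)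
  then have "\<forall>\<^sub>F n in sequentially. F n holomorphic_on ball z e"
  proof eventually_elim
    case (elim n)
    have "inverse (F n w) \<noteq> 0" if w: "w \<in> ball z e" for w
    proof
      assume "inverse (F n w) = 0"
      then have "norm (k w) < c" using elim(2) w by (metis dist_0_norm)
      then show False using big[OF w] by simp
    qed
    then have "(\<lambda>w. inverse (inverse (F n w))) holomorphic_on ball z e"
      by (intro holomorphic_on_inverse elim(1))
    then show ?case by simp
  qed
  moreover have "(\<lambda>w. inverse (k w)) holomorphic_on ball z e"
    by (intro holomorphic_on_inverse holomorphic_on_subset[OF k] nz) (use e in auto)
  ultimately have "disc_conv F (ball z e) (\<lambda>w. inverse (k w))" using ul by (simp add: disc_conv_def)
  then show ?thesis using e by blast
qed

text \<open>\<open>K n\<close> stands for \<open>1 / G n\<close> and \<open>\<delta> n\<close> for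
  the inverse of the shared value. As the derivative of \<open>1 / G\<close> is
  \<open>- deriv G / G\<^sup>2\<close>, the assumption \<open>der\<close> is the equation
  \<open>deriv (G n) = b\<close> at the points where \<open>G n\<close> takes that value.\<close>

lemma limit_zero_not_isolated:
  fixes b :: complex
  assumes conv: "disc_conv K (ball z d) k" and d: "d > 0" and kz: "k z = 0" and b: "b \<noteq> 0"
    and \<delta>: "\<delta> \<longlonglongrightarrow> 0" "\<And>n. \<delta> n \<noteq> 0"
    and der: "\<And>n w. w \<in> ball z d \<Longrightarrow> K n w = \<delta> n \<Longrightarrow> deriv (K n) w = - b * (\<delta> n)\<^sup>2"
  shows "\<exists>e>0. \<forall>w\<in>ball z e. k w = 0"
proof (rule ccontr)
  assume contra: "\<not> ?thesis"
  have k: "k holomorphic_on ball z d" using conv by (simp add: disc_conv_def)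
  have an: "k analytic_on {z}" using k d by (simp add: holomorphic_on_imp_analytic_at)
  have iz: "isolated_zero k z"
  proof (rule ccontr)
    assume "\<not> isolated_zero k z"
    then have "\<forall>\<^sub>F u in nhds z. k u = 0" using non_isolated_zero_imp_eventually_zero'[OF an kz] by blast
    then show False using contra unfolding eventually_nhds_metric by (auto simp: dist_commute)
  qed
  then obtain r0 where r0: "r0 > 0" "\<And>w. w \<noteq> z \<Longrightarrow> dist w z < r0 \<Longrightarrow> k w \<noteq> 0"
    unfolding isolated_zero_def eventually_at by blast
  \<comment> \<open>The circle avoids the zeros of \<open>k\<close>; the minimum \<open>c\<close> of
    \<open>norm k\<close> on it controls the denominators below.\<close>
  define r where "r = min r0 d / 2"
  have r: "0 < r" "r < r0" "r < d" using r0 d by (auto simp: r_def)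
  have sub: "cball z r \<subseteq> ball z d" using r by auto
  have contk: "continuous_on (cball z r) k"
    by (intro holomorphic_on_imp_continuous_on holomorphic_on_subset[OF k] sub)
  have contk': "continuous_on (cball z r) (deriv k)"
    by (intro holomorphic_on_imp_continuous_on holomorphic_on_subset[OF holomorphic_deriv[OF k]] sub) auto
  have "bounded (k ` cball z r)" "bounded (deriv k ` cball z r)"
    using contk contk' compact_continuous_image compact_imp_bounded compact_cball by blast+
  then obtain B1 B2 where "\<forall>w\<in>cball z r. norm (k w) \<le> B1" "\<forall>w\<in>cball z r. norm (deriv k w) \<le> B2"
    unfolding bounded_iff by blast
  then have B: "\<And>w. w \<in> cball z r \<Longrightarrow> norm (k w) \<le> B1"
    "\<And>w. w \<in> cball z r \<Longrightarrow> norm (deriv k w) \<le> B2" by blast+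
  have "sphere z r \<noteq> {}" using r by simp
  moreover have "continuous_on (sphere z r) (\<lambda>w. norm (k w))"
    by (intro continuous_intros continuous_on_subset[OF contk]) auto
  ultimately obtain x where x: "x \<in> sphere z r" "\<And>w. w \<in> sphere z r \<Longrightarrow> norm (k x) \<le> norm (k w)"
    using continuous_attains_inf[OF compact_sphere, of z r "\<lambda>w. norm (k w)"] by auto
  define c where "c = norm (k x)"
  have "k x \<noteq> 0" using r0(2)[of x] x(1) r by (auto simp: dist_commute)
  then have c: "c > 0" by (simp add: c_def)
  \<comment> \<open>In terms of \<open>G n\<close> this is
    \<open>(b - deriv (G n)) / (G n)\<^sup>2\<close>; by \<open>der\<close> it vanishes where
    \<open>K n = \<delta> n\<close>.\<close>
  define P where "P = (\<lambda>n w. deriv (K n) w + b * (K n w)\<^sup>2)"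
  \<comment> \<open>On the circle \<open>B\<close> bounds \<open>P n\<close>, while
    \<open>K n - \<delta> n\<close> has norm at least \<open>c / 2\<close>: one \<open>c / 4\<close>
    is lost to the convergence and one to \<open>\<delta> n\<close>. This gives
    \<open>M\<close>.\<close>
  define B where "B = (B2 + 1) + norm b * (B1 + c)\<^sup>2"
  define M where "M = 2 * B / c"
  have ulK: "uniform_limit (ball z d) K k sequentially" using conv by (simp add: disc_conv_def)
  have "\<forall>\<^sub>F n in sequentially. K n holomorphic_on ball z d" using conv by (simp add: disc_conv_def)
  moreover have "\<forall>\<^sub>F n in sequentially. \<forall>w\<in>ball z d. dist (K n w) (k w) < c / 4"
    using ulK divide_pos_pos[OF c zero_less_numeral] unfolding uniform_limit_iff by blast
  moreover have "\<forall>\<^sub>F n in sequentially. \<forall>w\<in>cball z r. dist (deriv (K n) w) (deriv k w) < 1"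
    using disc_conv_deriv[OF conv r(3)] by (simp add: uniform_limit_iff)
  moreover have "\<forall>\<^sub>F n in sequentially. dist (\<delta> n) 0 < c / 4"
    by (rule tendstoD[OF \<delta>(1)]) (use c in simp)
  ultimately have ev: "\<forall>\<^sub>F n in sequentially. \<forall>w\<in>ball z r. norm (P n w) \<le> M * norm (K n w - \<delta> n)"
  proof eventually_elim
    case (elim n)
    show ?case
    proof
      fix w assume w: "w \<in> ball z r"
      show "norm (P n w) \<le> M * norm (K n w - \<delta> n)"
      proof (rule quotient_bound_on_disc[where R = d and z = z and r = r and
              h = "\<lambda>w. K n w - \<delta> n" and p = "P n" and w = w])
        show "(\<lambda>w. K n w - \<delta> n) holomorphic_on ball z d" by (intro holomorphic_intros elim(1))
        show "P n holomorphic_on ball z d" unfolding P_def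
          by (intro holomorphic_intros elim(1) holomorphic_deriv) auto
        show "P n u = 0 \<and> deriv (\<lambda>w. K n w - \<delta> n) u \<noteq> 0" if u: "u \<in> ball z r" "K n u - \<delta> n = 0" for u
        proof -
          have ud: "u \<in> ball z d" using u(1) r by simp
          have "K n field_differentiable at u"
            using elim(1) ud holomorphic_on_imp_differentiable_at open_ball by blast
          then have "deriv (\<lambda>w. K n w - \<delta> n) u = deriv (K n) u"
            by (subst deriv_diff) auto
          then show ?thesis using der[OF ud, of n] u(2) b \<delta>(2)[of n] by (simp add: P_def)
        qed
        fix u assume u: "u \<in> sphere z r"
        then have uc: "u \<in> cball z r" "u \<in> ball z d" using r by auto
        have "c \<le> norm (k u)" using x(2)[OF u] by (simp add: c_def)
        moreover have "norm (K n u - k u) < c / 4" using elim(2) uc by (simp add: dist_norm)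
        moreover have "norm (\<delta> n) < c / 4" using elim(4) by simp
        moreover have "norm (k u) \<le> norm (K n u - \<delta> n) + norm (K n u - k u) + norm (\<delta> n)"
          using norm_triangle_ineq[of "K n u - \<delta> n" "\<delta> n - (K n u - k u)"]
            norm_triangle_ineq4[of "\<delta> n" "K n u - k u"] by simp
        ultimately have low: "c / 2 \<le> norm (K n u - \<delta> n)" by linarith
        have "norm (K n u) \<le> B1 + c"
          using B(1)[OF uc(1)] \<open>norm (K n u - k u) < c / 4\<close> norm_triangle_sub[of "K n u" "k u"] c by linarith
        then have "norm b * (norm (K n u))\<^sup>2 \<le> norm b * (B1 + c)\<^sup>2"
          by (intro mult_left_mono power_mono) auto
        moreover have "norm (deriv (K n) u) \<le> B2 + 1"
          using B(2)[OF uc(1)] elim(3) uc(1) norm_triangle_sub[of "deriv (K n) u" "deriv k u"]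
          by (fastforce simp: dist_norm)
        moreover have "norm (P n u) \<le> norm (deriv (K n) u) + norm b * (norm (K n u))\<^sup>2"
          unfolding P_def using norm_triangle_ineq[of "deriv (K n) u" "b * (K n u)\<^sup>2"]
          by (simp add: norm_mult norm_power)
        ultimately have PB: "norm (P n u) \<le> B" by (simp add: B_def)
        then have "B \<ge> 0" using norm_ge_zero order_trans by blast
        then have "B \<le> M * norm (K n u - \<delta> n)"
          using mult_left_mono[OF low, of M] c by (simp add: M_def)
        then show "K n u - \<delta> n \<noteq> 0 \<and> norm (P n u) \<le> M * norm (K n u - \<delta> n)"
          using PB low c by auto
      qed (use r w in auto)
    qed
  qed
  \<comment> \<open>In the limit \<open>\<delta>\<close> disappears, and the quadratic term is a
    bounded multiple of \<open>k\<close>, so the inequality becomes linear.\<close>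
  have "norm (deriv k w) \<le> (M + norm b * B1) * norm (k w)" if w: "w \<in> ball z r" for w
  proof -
    have wd: "w \<in> ball z d" using w r by simp
    note lim = disc_conv_pointwise[OF conv wd]
    have l1: "(\<lambda>n. norm (P n w)) \<longlonglongrightarrow> norm (deriv k w + b * (k w)\<^sup>2)"
      unfolding P_def by (intro tendsto_intros lim)
    have l2: "(\<lambda>n. M * norm (K n w - \<delta> n)) \<longlonglongrightarrow> M * norm (k w - 0)"
      by (intro tendsto_intros lim \<delta>(1))
    have "\<forall>\<^sub>F n in sequentially. norm (P n w) \<le> M * norm (K n w - \<delta> n)"
      using ev by eventually_elim (use w in blast)
    then have "norm (deriv k w + b * (k w)\<^sup>2) \<le> M * norm (k w - 0)"
      by (rule tendsto_le[OF _ l2 l1, rotated]) simp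
    moreover have "norm (deriv k w) \<le> norm (deriv k w + b * (k w)\<^sup>2) + norm (b * (k w)\<^sup>2)"
      using norm_triangle_ineq4[of "deriv k w + b * (k w)\<^sup>2" "b * (k w)\<^sup>2"] by simp
    moreover have "norm (b * (k w)\<^sup>2) = norm b * (norm (k w) * norm (k w))"
      by (simp add: norm_mult power2_eq_square)
    moreover have "norm b * (norm (k w) * norm (k w)) \<le> norm b * (B1 * norm (k w))"
      using B(1)[of w] w by (intro mult_left_mono mult_right_mono) auto
    ultimately show ?thesis by (simp add: algebra_simps)
  qed
  moreover have "k holomorphic_on ball z r" using k by (rule holomorphic_on_subset) (use sub in auto)
  ultimately show False using zero_if_deriv_le[of k z r "M + norm b * B1"] r(1) kz contra by blast
qed

section \<open>Normality\<close>

lemma conv_chart_Infty: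
  assumes "conv_chart F L U" "z \<in> U" "L z = Infty"
  obtains k where "disc_conv_inverse F U k" "\<And>w. w \<in> U \<Longrightarrow> L w = sphere_inverse (k w)" "k z = 0"
proof -
  have "\<not> (\<forall>w\<in>U. L w = Finite (h w))" for h
    using assms(2,3) by (metis riemann_sphere.distinct(1))
  then obtain k where k: "disc_conv_inverse F U k" "\<forall>w\<in>U. L w = sphere_inverse (k w)"
    using assms(1) unfolding conv_chart_def by blast
  then have "sphere_inverse (k z) = Infty" using assms(2,3) by simp
  then have "k z = 0" by (cases "k z = 0") auto
  then show ?thesis using that k by blast
qed

text \<open>To be applied to \<open>f - a\<close> with \<open>\<beta> = b - a\<close>: dividing
  values by \<open>\<rho> n\<close> preserves zeros but moves every other value, so the a-points
  have to be zeros.\<close>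

lemma bounded_spherical_deriv_if_share:
  fixes F :: "complex \<Rightarrow> complex" and A :: real and b \<beta> :: complex
  assumes F: "F nicely_meromorphic_on UNIV" and A: "norm b \<le> A" and b: "b \<noteq> 0" and \<beta>: "\<beta> \<noteq> 0"
    and zeros: "\<And>z. \<not> is_pole F z \<Longrightarrow> F z = 0 \<Longrightarrow> norm (deriv F z) \<le> A"
    and share: "\<And>z. \<not> is_pole F z \<Longrightarrow> F z = \<beta> \<longleftrightarrow> deriv F z = b"
  shows "\<exists>C. sph_deriv_le F C UNIV"
proof (rule ccontr)
  assume "\<not> ?thesis"
  then have unb: "\<And>C. \<not> sph_deriv_le F C UNIV" by blast
  have A0: "A \<ge> 0" using A norm_ge_zero order_trans by blast
  obtain p :: "nat \<Rightarrow> complex" and \<rho> :: "nat \<Rightarrow> real" and g :: "nat \<Rightarrow> complex \<Rightarrow> complex" where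
    \<rho>: "\<And>n. \<rho> n > 0" "\<rho> \<longlonglongrightarrow> 0"
    and g: "\<And>n. g n = (\<lambda>z. inverse (of_real (\<rho> n)) * F (p n + of_real (\<rho> n) * z))"
    and g0: "\<And>n. \<not> is_pole (g n) 0" "\<And>n. norm (deriv (g n) 0) > (A + 1) * (1 + (norm (g n 0))\<^sup>2)"
    and gle: "\<And>R. \<forall>\<^sub>F n in sequentially. sph_deriv_le (g n) (16 * (A + 1)) (ball 0 R)"
    by (rule Pang_Zalcman[OF F A0 _ unb]) ((rule zeros; assumption) | (rule that; assumption))+
  have \<rho>nz: "complex_of_real (\<rho> n) \<noteq> 0" for n using \<rho>(1)[of n] by simp
  have nice: "g n nicely_meromorphic_on UNIV" for n
    unfolding g by (rule rescaled_deriv(1)[OF F \<rho>nz])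
  have pole: "is_pole (g n) z \<longleftrightarrow> is_pole F (p n + of_real (\<rho> n) * z)" for n z
    unfolding g by (rule rescaled_deriv(2)[OF F \<rho>nz])
  have der: "deriv (g n) z = deriv F (p n + of_real (\<rho> n) * z)" if "\<not> is_pole (g n) z" for n z
    using rescaled_deriv(3)[OF F \<rho>nz, of "p n" n z] that pole[of n z] unfolding g by blast
  have loc: "\<exists>d>0. \<exists>C. \<forall>\<^sub>F n in sequentially. sph_deriv_le (g n) C (ball z d)" for z
  proof -
    have "ball z 1 \<subseteq> ball 0 (norm z + 1)"
    proof
      fix u assume "u \<in> ball z 1"
      then show "u \<in> ball 0 (norm z + 1)"
        using norm_triangle_sub[of u z] by (simp add: dist_norm norm_minus_commute)
    qed
    then have "sph_deriv_le h C (ball 0 (norm z + 1)) \<Longrightarrow> sph_deriv_le h C (ball z 1)" for h C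
      unfolding sph_deriv_le_def by blast
    then have "\<forall>\<^sub>F n in sequentially. sph_deriv_le (g n) (16 * (A + 1)) (ball z 1)"
      by (rule eventually_mono[OF gle])
    then show ?thesis using zero_less_one by blast
  qed
  obtain r L where r: "strict_mono r" and chart: "\<And>z. \<exists>d>0. conv_chart (g \<circ> r) L (ball z d)"
    using Marty[OF nice loc] by blast
  define G where "G = g \<circ> r"
  \<comment> \<open>\<open>inverse (\<delta> n)\<close> is the value of \<open>G n\<close> that
    corresponds to the value \<open>\<beta>\<close> of \<open>F\<close>.\<close>
  define \<delta> where "\<delta> = (\<lambda>n. of_real (\<rho> (r n)) / \<beta>)"
  have \<delta>nz: "\<delta> n \<noteq> 0" for n using \<rho>nz \<beta> by (simp add: \<delta>_def)
  have "(\<lambda>n. \<rho> (r n)) \<longlonglongrightarrow> 0" using LIMSEQ_subseq_LIMSEQ[OF \<rho>(2) r] by (simp add: o_def)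
  then have "(\<lambda>n. of_real (\<rho> (r n)) / \<beta>) \<longlonglongrightarrow> of_real 0 / \<beta>" by (intro tendsto_intros \<beta>)
  then have \<delta>0: "\<delta> \<longlonglongrightarrow> 0" by (simp add: \<delta>_def)
  have Gnice: "G n nicely_meromorphic_on UNIV" for n by (simp add: G_def nice)
  have Gshare: "G n z = inverse (\<delta> n) \<longleftrightarrow> deriv (G n) z = b" if "\<not> is_pole (G n) z" for n z
  proof -
    have "F (p (r n) + of_real (\<rho> (r n)) * z) = \<beta> \<longleftrightarrow> deriv (G n) z = b"
      using share that pole der by (simp add: G_def)
    moreover have "G n z = inverse (\<delta> n) \<longleftrightarrow> F (p (r n) + of_real (\<rho> (r n)) * z) = \<beta>"
      using \<rho>nz[of "r n"] \<beta> by (simp add: G_def g \<delta>_def field_simps)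
    ultimately show ?thesis by simp
  qed
  have Gzero: "norm (deriv (G n) z) \<le> A" if "\<not> is_pole (G n) z" "G n z = 0" for n z
    using zeros[of "p (r n) + of_real (\<rho> (r n)) * z"] that pole der \<rho>nz[of "r n"]
    by (simp add: G_def g)
  have G0: "\<not> is_pole (G n) 0" "norm (deriv (G n) 0) > (A + 1) * (1 + (norm (G n 0))\<^sup>2)" for n
    using g0 by (simp_all add: G_def)
  have Gle: "\<forall>\<^sub>F n in sequentially. sph_deriv_le (G n) (16 * (A + 1)) (ball 0 R)" for R
    using eventually_subseq[OF r gle] by (simp add: G_def)
  note chart = chart[folded G_def]
  show False
    using conv_limit_cases[OF chart]
  proof
    \<comment> \<open>The inverses tend to 0 together with their derivatives, so eventually
      \<open>norm (deriv (G n) 0) < (norm (G n 0))\<^sup>2\<close>, against the normalization at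
      0.\<close>
    assume L: "L = (\<lambda>_. Infty)"
    obtain d where d: "d > 0" "conv_chart G L (ball 0 d)" using chart by blast
    obtain k where k: "disc_conv_inverse G (ball 0 d) k" "\<And>w. w \<in> ball 0 d \<Longrightarrow> L w = sphere_inverse (k w)"
      using conv_chart_Infty[OF d(2), of 0] d(1) L by auto
    have k0: "k w = 0" if "w \<in> ball 0 d" for w
      using k(2)[OF that] L by (cases "k w = 0") auto
    have "deriv k 0 = deriv (\<lambda>_. 0) 0"
      by (rule deriv_cong_ev)
        (use k0 d eventually_nhds_in_open[of "ball 0 d" 0] in \<open>auto elim: eventually_mono\<close>)
    then have "(\<lambda>n. deriv (\<lambda>w. inverse (G n w)) 0) \<longlonglongrightarrow> 0"
      using disc_conv_pointwise(2)[of "\<lambda>n w. inverse (G n w)" 0 d k 0] k(1) d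
      by (simp add: disc_conv_inverse_def)
    then have "\<forall>\<^sub>F n in sequentially. dist (deriv (\<lambda>w. inverse (G n w)) 0) 0 < 1"
      by (rule tendstoD) simp
    moreover have "\<forall>\<^sub>F n in sequentially. \<forall>w\<in>ball 0 d. G n w = 0 \<longrightarrow> is_pole (G n) w"
      using k(1) by (simp add: disc_conv_inverse_def)
    ultimately have "\<forall>\<^sub>F n in sequentially. False"
    proof eventually_elim
      case (elim n)
      have nz: "G n 0 \<noteq> 0" using elim(2) G0(1) d(1) by auto
      have "norm (deriv (G n) 0) < (norm (G n 0))\<^sup>2"
        using elim(1) nz unfolding deriv_inverse_norm[OF Gnice nz]
        by (simp add: norm_divide norm_power)
      also have "\<dots> \<le> (A + 1) * (1 + (norm (G n 0))\<^sup>2)"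
        using A0 mult_mono[of 1 "A + 1" "(norm (G n 0))\<^sup>2" "1 + (norm (G n 0))\<^sup>2"] by simp
      finally show False using G0(2)[of n] by simp
    qed
    then show False by simp
  next
    assume "\<exists>h. h nicely_meromorphic_on UNIV \<and> L = to_sphere h"
    then obtain h where h: "h nicely_meromorphic_on UNIV" "L = to_sphere h" by blast
    \<comment> \<open>At a pole, \<open>limit_zero_not_isolated\<close> makes \<open>L\<close>
      infinite on a whole disc, although poles of \<open>h\<close> are isolated.\<close>
    have no_pole: "\<not> is_pole h z" for z
    proof
      assume hz: "is_pole h z"
      then have Lz: "L z = Infty" by (simp add: h(2) to_sphere_def)
      obtain d where d: "d > 0" "conv_chart G L (ball z d)" using chart by blast
      have zd: "z \<in> ball z d" using d by simp
      then obtain k where k: "disc_conv_inverse G (ball z d) k"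
        "\<And>w. w \<in> ball z d \<Longrightarrow> L w = sphere_inverse (k w)" and kz: "k z = 0"
        using conv_chart_Infty[OF d(2) _ Lz] by blast
      have "\<exists>e>0. \<forall>w\<in>ball z e. k w = 0"
      proof (rule limit_zero_not_isolated[where K = "\<lambda>n w. inverse (G n w)" and k = k and z = z and d = d and
            b = b and \<delta> = \<delta>])
        show "disc_conv (\<lambda>n w. inverse (G n w)) (ball z d) k" using k(1) by (simp add: disc_conv_inverse_def)
        fix n w assume eq: "inverse (G n w) = \<delta> n"
        then have nz: "G n w \<noteq> 0" using \<delta>nz[of n] by auto
        have "G n w = inverse (\<delta> n)" using eq by (metis inverse_inverse_eq)
        then have "deriv (G n) w = b"
          using Gshare[of n w] nicely_meromorphic_nonzero_not_pole[OF Gnice nz] by blast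
        then show "deriv (\<lambda>w. inverse (G n w)) w = - b * (\<delta> n)\<^sup>2"
          unfolding deriv_inverse_norm[OF Gnice nz] using \<open>G n w = inverse (\<delta> n)\<close>
          by (simp add: power_inverse divide_inverse)
      qed (use d(1) kz b \<delta>0 \<delta>nz in auto)
      then obtain e where e: "e > 0" "\<forall>w\<in>ball z e. k w = 0" by blast
      have "h meromorphic_on {z}"
        using h(1) by (auto simp: nicely_meromorphic_on_def intro: meromorphic_on_subset)
      then have "\<forall>\<^sub>F w in at z. \<not> is_pole h w"
        by (intro eventually_not_pole meromorphic_on_isolated_singularity)
      moreover have "\<forall>\<^sub>F w in at z. w \<in> ball z (min d e)"
        by (rule eventually_at_in_open') (use d e in auto)
      ultimately have "\<forall>\<^sub>F w in at z. False"
      proof eventually_elim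
        case (elim w)
        have "L w = Infty" using k(2) e(2) elim(2) by simp
        then show False using elim(1) by (simp add: h(2) to_sphere_def)
      qed
      then show False by simp
    qed
    have "h analytic_on UNIV" using nicely_meromorphic_without_singularities[OF h(1)] no_pole by blast
    then have hol: "h holomorphic_on UNIV" by (rule analytic_imp_holomorphic)
    have Lh: "L z = Finite (h z)" for z using no_pole by (simp add: h(2) to_sphere_def)
    \<comment> \<open>All values of the limit are finite now, so an inverse chart can be exchanged
      for a finite one on a smaller disc.\<close>
    have conv: "\<exists>d>0. disc_conv G (ball z d) h" for z
    proof -
      obtain d where d: "d > 0" "conv_chart G L (ball z d)" using chart by blast
      from d(2) show ?thesis unfolding conv_chart_def
      proof (elim disjE exE conjE)
        fix h' assume "disc_conv G (ball z d) h'" "\<forall>w\<in>ball z d. L w = Finite (h' w)"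
        then have "disc_conv G (ball z d) h" using disc_conv_cong[of G "ball z d" h' h] Lh by simp
        then show ?thesis using d(1) by blast
      next
        fix k assume k: "disc_conv_inverse G (ball z d) k" "\<forall>w\<in>ball z d. L w = sphere_inverse (k w)"
        have kh: "h w = inverse (k w) \<and> k w \<noteq> 0" if "w \<in> ball z d" for w
          using k(2) that Lh[of w] by (cases "k w = 0") auto
        obtain e where e: "e > 0" "e \<le> d" "disc_conv G (ball z e) (\<lambda>w. inverse (k w))"
          using disc_conv_inverse_finite[OF k(1) d(1)] kh[of z] d(1) by auto
        have "disc_conv G (ball z e) h"
          by (rule disc_conv_cong[OF e(3)]) (use kh e(2) in auto)
        then show ?thesis using e(1) by blast
      qed
    qed
    have pw: "(\<lambda>n. G n z) \<longlonglongrightarrow> h z" "(\<lambda>n. deriv (G n) z) \<longlonglongrightarrow> deriv h z"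
      "\<forall>\<^sub>F n in sequentially. \<not> is_pole (G n) z" for z
    proof -
      obtain d where d: "d > 0" "disc_conv G (ball z d) h" using conv by blast
      then have zd: "z \<in> ball z d" by simp
      show "(\<lambda>n. G n z) \<longlonglongrightarrow> h z" "(\<lambda>n. deriv (G n) z) \<longlonglongrightarrow> deriv h z"
        using disc_conv_pointwise[OF d(2) zd] by auto
      have "\<forall>\<^sub>F n in sequentially. G n holomorphic_on ball z d" using d(2) by (simp add: disc_conv_def)
      then show "\<forall>\<^sub>F n in sequentially. \<not> is_pole (G n) z"
        by eventually_elim (use not_is_pole_holomorphic[OF open_ball zd] in blast)
    qed
    have hd0: "norm (deriv h 0) \<ge> A + 1"
    proof (rule tendsto_lowerbound[OF tendsto_norm[OF pw(2)]])
      have "A + 1 \<le> norm (deriv (G n) 0)" for n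
      proof -
        have "(A + 1) * 1 \<le> (A + 1) * (1 + (norm (G n 0))\<^sup>2)" using A0 by (intro mult_left_mono) auto
        then show ?thesis using G0(2)[of n] by simp
      qed
      then show "\<forall>\<^sub>F n in sequentially. A + 1 \<le> norm (deriv (G n) 0)" by simp
    qed simp
    have hbd: "norm (deriv h z) \<le> 16 * (A + 1) * (1 + (norm (h z))\<^sup>2)" for z
    proof (rule tendsto_le[OF _ _ tendsto_norm[OF pw(2)]])
      show "(\<lambda>n. 16 * (A + 1) * (1 + (norm (G n z))\<^sup>2)) \<longlonglongrightarrow> 16 * (A + 1) * (1 + (norm (h z))\<^sup>2)"
        by (intro tendsto_intros pw)
      show "\<forall>\<^sub>F n in sequentially. norm (deriv (G n) z) \<le> 16 * (A + 1) * (1 + (norm (G n z))\<^sup>2)"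
        using Gle[of "norm z + 1"] pw(3)[of z]
        by eventually_elim (simp add: sph_deriv_le_def)
    qed simp
    \<comment> \<open>Near any point \<open>G n\<close> stays bounded while
      \<open>inverse (\<delta> n)\<close> tends to infinity, so eventually
      \<open>deriv (G n)\<close> omits \<open>b\<close> there. Hurwitz's theorem then leaves only
      \<open>deriv h = b\<close> throughout, which \<open>hd0\<close> and
      \<open>norm b \<le> A\<close> exclude.\<close>
    have omit: "deriv h z \<noteq> b" for z
    proof
      assume hz: "deriv h z = b"
      obtain d where d: "d > 0" "disc_conv G (ball z d) h" using conv by blast
      define e where "e = d / 2"
      have e: "e > 0" "e < d" using d by (auto simp: e_def)
      have "bounded (h ` cball z e)"
        by (intro compact_imp_bounded compact_continuous_image holomorphic_on_imp_continuous_on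
            holomorphic_on_subset[OF hol]) auto
      then obtain B where B: "\<forall>w\<in>cball z e. norm (h w) \<le> B" unfolding bounded_iff by blast
      have "filterlim (\<lambda>n. inverse (\<delta> n)) at_infinity sequentially"
        using \<delta>0 \<delta>nz by (intro filterlim_compose[OF filterlim_inverse_at_infinity]) (simp add: filterlim_at)
      then have "\<forall>\<^sub>F n in sequentially. norm (inverse (\<delta> n)) \<ge> B + 1"
        unfolding filterlim_at_infinity_conv_norm_at_top filterlim_at_top by blast
      moreover have "\<forall>\<^sub>F n in sequentially. G n holomorphic_on ball z d" using d(2) by (simp add: disc_conv_def)
      moreover have "\<forall>\<^sub>F n in sequentially. \<forall>w\<in>ball z d. dist (G n w) (h w) < 1"
        using d(2) by (simp add: disc_conv_def uniform_limit_iff)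
      ultimately have "\<forall>\<^sub>F n in sequentially. \<forall>w\<in>ball z e. deriv (G n) w - b \<noteq> 0"
      proof eventually_elim
        case (elim n)
        show ?case
        proof
          fix w assume w: "w \<in> ball z e"
          have wd: "w \<in> ball z d" using w e by simp
          have "norm (G n w) < B + 1"
          proof -
            have "norm (h w) \<le> B" using B w by simp
            moreover have "norm (G n w - h w) < 1" using elim(3) wd by (simp add: dist_norm)
            ultimately show ?thesis using norm_triangle_sub[of "G n w" "h w"] by linarith
          qed
          then have "G n w \<noteq> inverse (\<delta> n)" using elim(1) by auto
          then show "deriv (G n) w - b \<noteq> 0"
            using Gshare[of n w] not_is_pole_holomorphic[OF open_ball wd elim(2)] by simp
        qed
      qed
      then have "\<forall>w\<in>ball z e. deriv h w - b = 0"
        using Hurwitz_disc[OF disc_conv_diff_const[OF disc_conv_deriv_disc[OF d(2) e(2)]] e(1), of b] hz by simp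
      then have "deriv h 0 = b"
        using analytic_continuation_open[of "ball z e" UNIV "deriv h" "\<lambda>_. b" 0] e(1)
          holomorphic_deriv[OF hol open_UNIV] by auto
      then show False using hd0 A by simp
    qed
    obtain s where s: "\<And>z. deriv h z = s"
      using entire_bounded_spherical_deriv_omit[OF hol hbd b omit] by blast
    have s1: "norm s \<ge> A + 1" using hd0 s by simp
    then have snz: "s \<noteq> 0" using A0 by auto
    have "((\<lambda>z. h z - s * z) has_field_derivative 0) (at z)" for z
      using holomorphic_derivI[OF hol open_UNIV, of z] s[of z] by (auto intro!: derivative_eq_intros)
    then obtain c where c: "\<And>z. h z - s * z = c"
      using has_field_derivative_zero_constant[of UNIV "\<lambda>z. h z - s * z"] by auto
    \<comment> \<open>The zero of the affine limit. A zero of \<open>G n\<close> near it would have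
      slope at most \<open>A\<close>, but \<open>deriv (G n)\<close> differs by less than 1 from
      \<open>s\<close>, whose norm is at least \<open>A + 1\<close>. So \<open>G n\<close> is
      zero-free there, and Hurwitz's theorem makes the non-constant \<open>h\<close> vanish on a
      disc.\<close>
    define z where "z = - c / s"
    have hz: "h z = 0" using c[of z] snz by (simp add: z_def)
    obtain d where d: "d > 0" "disc_conv G (ball z d) h" using conv by blast
    define e where "e = d / 2"
    have e: "e > 0" "e < d" using d by (auto simp: e_def)
    have "\<forall>\<^sub>F n in sequentially. \<forall>w\<in>cball z e. dist (deriv (G n) w) (deriv h w) < 1"
      using disc_conv_deriv[OF d(2) e(2)] by (simp add: uniform_limit_iff)
    moreover have "\<forall>\<^sub>F n in sequentially. G n holomorphic_on ball z d" using d(2) by (simp add: disc_conv_def)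
    ultimately have "\<forall>\<^sub>F n in sequentially. \<forall>w\<in>ball z e. G n w \<noteq> 0"
    proof eventually_elim
      case (elim n)
      show ?case
      proof (intro ballI notI)
        fix w assume w: "w \<in> ball z e" "G n w = 0"
        then have wd: "w \<in> ball z d" using e by simp
        have "norm (deriv (G n) w) \<le> A"
          using Gzero[OF not_is_pole_holomorphic[OF open_ball wd elim(2)] w(2)] .
        moreover have "norm (deriv (G n) w - s) < 1" using elim(1) w(1) s by (simp add: dist_norm)
        ultimately show False using s1 norm_triangle_sub[of s "deriv (G n) w"] norm_minus_commute[of s "deriv (G n) w"]
          by linarith
      qed
    qed
    moreover have "ball z e \<subseteq> ball z d" using e(2) by auto
    ultimately have h0: "\<forall>w\<in>ball z e. h w = 0"
      using Hurwitz_disc[OF disc_conv_subset[OF d(2)] e(1) _ hz] by blast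
    have hc: "h w = s * w + c" for w using c[of w] by (simp add: algebra_simps)
    define u where "u = z + of_real (e / 2)"
    have "u \<in> ball z e" using e(1) by (simp add: u_def dist_norm)
    then have "s * u + c = s * z + c" using h0 hz hc by metis
    then show False using snz e(1) by (simp add: u_def)
  qed
qed

section \<open>From a bounded spherical derivative to normality, and back from \<open>f - a\<close>
  to \<open>f\<close>\<close>

text \<open>Translation preserves the bound, so one constant serves the whole family and Marty's
  theorem applies to any sequence of translates.\<close>

lemma normal_function_if_bounded_spherical_deriv:
  assumes f: "f nicely_meromorphic_on UNIV" and le: "sph_deriv_le f C UNIV"
  shows "normal_function (to_sphere f)"
  unfolding normal_function_def normal_family_def
proof (intro allI impI)
  fix \<zeta> :: "nat \<Rightarrow> complex" and H :: "nat \<Rightarrow> complex \<Rightarrow> riemann_sphere"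
  assume "\<forall>n. H n \<in> range (\<lambda>n z. to_sphere f (\<zeta> n + z))"
  \<comment> \<open>A sequence in the family may repeat or reorder the translates;
    \<open>j n\<close> is an index for its n-th member.\<close>
  then have "\<forall>n. \<exists>j. H n = (\<lambda>z. to_sphere f (\<zeta> j + z))" by blast
  then obtain j where j: "\<And>n. H n = (\<lambda>z. to_sphere f (\<zeta> (j n) + z))" by metis
  define F where "F = (\<lambda>n z. f (\<zeta> (j n) + z))"
  note shift = rescaled_deriv[OF f one_neq_zero, simplified]
  have nice: "F n nicely_meromorphic_on UNIV" for n unfolding F_def by (rule shift(1))
  have pole: "is_pole (F n) z \<longleftrightarrow> is_pole f (\<zeta> (j n) + z)" for n z unfolding F_def by (rule shift(2))
  have "F n z = f (\<zeta> (j n) + z)" for n z by (simp add: F_def)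
  then have "H n z = to_sphere (F n) z" for n z by (simp add: j to_sphere_def pole)
  then have HF: "H n = to_sphere (F n)" for n by (rule ext)
  have "sph_deriv_le (F n) C S" for n S
    using le shift(3) pole unfolding sph_deriv_le_def F_def by simp
  then have "\<exists>d>0. \<exists>C. \<forall>\<^sub>F n in sequentially. sph_deriv_le (F n) C (ball z d)" for z
    by (intro exI[of _ 1] conjI exI[of _ C]) auto
  then obtain r L where r: "strict_mono r" and chart: "\<And>z. \<exists>d>0. conv_chart (F \<circ> r) L (ball z d)"
    using Marty[of F, OF nice] by blast
  have "spherically_loc_unif_conv (H \<circ> r) L"
    unfolding spherically_loc_unif_conv_def
  proof
    fix z
    obtain d where d: "d > 0" "conv_chart (F \<circ> r) L (ball z d)" using chart by blast
    have "\<forall>\<^sub>F n in sequentially. \<forall>w\<in>ball z d. spherical_dist ((H \<circ> r) n w) (L w) < e" if "e > 0" for e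
      using conv_chart_imp_spherical[OF _ d(2) open_ball that] nice by (simp add: HF)
    then show "\<exists>d>0. \<forall>e>0. \<forall>\<^sub>F n in sequentially. \<forall>w\<in>ball z d. spherical_dist ((H \<circ> r) n w) (L w) < e"
      using d(1) by blast
  qed
  moreover have "(\<exists>h. h nicely_meromorphic_on UNIV \<and> L = to_sphere h) \<or> L = (\<lambda>_. Infty)"
    using conv_limit_cases[OF chart] by blast
  ultimately show "\<exists>r g. strict_mono r \<and> spherically_loc_unif_conv (H \<circ> r) g \<and>
      ((\<exists>h. h nicely_meromorphic_on UNIV \<and> g = to_sphere h) \<or> g = (\<lambda>_. Infty))"
    using r by blast
qed

text \<open>Plain subtraction gives the value \<open>- a\<close> at the poles of \<open>f\<close>,
  where the convention demands 0; \<open>remove_sings\<close> repairs this and leaves the values at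
  regular points alone.\<close>

lemma nicely_meromorphic_minus_const:
  assumes f: "f nicely_meromorphic_on UNIV"
  obtains F where "F nicely_meromorphic_on UNIV" "\<And>z. is_pole F z \<longleftrightarrow> is_pole f z"
    "\<And>z. \<not> is_pole f z \<Longrightarrow> F z = f z - a" "\<And>z. \<not> is_pole f z \<Longrightarrow> deriv F z = deriv f z"
proof -
  define F where "F = remove_sings (\<lambda>z. f z - a)"
  have mero: "(\<lambda>z. f z - a) meromorphic_on UNIV"
    using f by (auto simp: nicely_meromorphic_on_def intro!: meromorphic_intros)
  have F: "F nicely_meromorphic_on UNIV" unfolding F_def by (rule remove_sings_nicely_meromorphic[OF mero])
  have iso: "isolated_singularity_at (\<lambda>z. f z - a) z" for z
    by (rule meromorphic_on_isolated_singularity) (use mero in \<open>auto intro: meromorphic_on_subset\<close>)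
  have pole: "is_pole F z \<longleftrightarrow> is_pole f z" for z
    using is_pole_remove_sings_iff[OF iso, of z] is_pole_plus_const_iff[of f z "- a"] by (simp add: F_def)
  have val: "F z = f z - a" if "\<not> is_pole f z" for z
  proof -
    have "(\<lambda>z. f z - a) analytic_on {z}"
      by (intro analytic_intros nicely_meromorphic_has_deriv(1)[OF f that])
    then show ?thesis unfolding F_def by (rule remove_sings_at_analytic)
  qed
  have "deriv F z = deriv f z" if z: "\<not> is_pole f z" for z
  proof -
    have "\<forall>\<^sub>F u in at z. \<not> is_pole f u"
      by (intro eventually_not_pole meromorphic_on_isolated_singularity)
        (use f in \<open>auto simp: nicely_meromorphic_on_def intro: meromorphic_on_subset\<close>)
    then have "\<forall>\<^sub>F u in nhds z. \<not> is_pole f u" using z by (simp add: eventually_nhds_conv_at)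
    then have "\<forall>\<^sub>F u in nhds z. F u = f u - a" by eventually_elim (rule val)
    then have "deriv F z = deriv (\<lambda>u. f u - a) z" by (rule deriv_cong_ev) simp
    also have "((\<lambda>u. f u - a) has_field_derivative deriv f z - 0) (at z)"
      by (intro DERIV_diff DERIV_const nicely_meromorphic_has_deriv(2)[OF f z])
    then have "deriv (\<lambda>u. f u - a) z = deriv f z" by (simp add: DERIV_imp_deriv)
    finally show ?thesis .
  qed
  then show ?thesis using that[OF F pole val] by blast
qed

theorem theorem2p2:
  fixes f :: "complex \<Rightarrow> complex" and a b :: complex
  assumes "f nicely_meromorphic_on UNIV"
    and "a \<noteq> b" and "b \<noteq> 0"
    and "bounded (deriv f ` {z. to_sphere f z = Finite a})"
    and "\<forall>z. to_sphere f z = Finite b \<longleftrightarrow> to_sphere (deriv f) z = Finite b"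
  shows "normal_function (to_sphere f)"
proof -
  note f = assms(1)
  obtain F where F: "F nicely_meromorphic_on UNIV" and pole: "\<And>z. is_pole F z \<longleftrightarrow> is_pole f z"
    and val: "\<And>z. \<not> is_pole f z \<Longrightarrow> F z = f z - a"
    and der: "\<And>z. \<not> is_pole f z \<Longrightarrow> deriv F z = deriv f z"
    using nicely_meromorphic_minus_const[OF f] by blast
  obtain A0 where A0: "\<And>z. to_sphere f z = Finite a \<Longrightarrow> norm (deriv f z) \<le> A0"
    using assms(4) unfolding bounded_iff by blast
  \<comment> \<open>\<open>norm b\<close> is included so that the limit with derivative
    \<open>b\<close> is excluded as well.\<close>
  define A where "A = max A0 (norm b)"
  have "\<exists>C. sph_deriv_le F C UNIV"
  proof (rule bounded_spherical_deriv_if_share[OF F _ assms(3)])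
    show "norm b \<le> A" by (simp add: A_def)
    show "b - a \<noteq> 0" using assms(2) by simp
    fix z assume "\<not> is_pole F z"
    then have z: "\<not> is_pole f z" by (simp add: pole)
    show "norm (deriv F z) \<le> A" if "F z = 0"
      using A0[of z] that z val[OF z] der[OF z] by (simp add: to_sphere_def A_def)
    \<comment> \<open>The sharing hypothesis speaks of values on the sphere; at a regular point of
      \<open>f\<close> it thereby becomes an equivalence of equations between numbers.\<close>
    have "is_pole (deriv f) z \<longleftrightarrow> is_pole f z"
      by (rule is_pole_deriv_iff)
        (use f in \<open>auto simp: nicely_meromorphic_on_def intro: meromorphic_on_subset\<close>)
    then have "f z = b \<longleftrightarrow> deriv f z = b"
      using assms(5)[rule_format, of z] z by (simp add: to_sphere_def)
    then show "F z = b - a \<longleftrightarrow> deriv F z = b" using val[OF z] der[OF z] by simp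
  qed
  then obtain C where C: "sph_deriv_le F C UNIV" by blast
  \<comment> \<open>Translation by \<open>a\<close> distorts the spherical metric by a bounded
    factor, which comes from
    \<open>(x + y)\<^sup>2 \<le> 2 * x\<^sup>2 + 2 * y\<^sup>2\<close>.\<close>
  have "sph_deriv_le f (\<bar>C\<bar> * (2 + 2 * (norm a)\<^sup>2)) UNIV"
    unfolding sph_deriv_le_def
  proof (intro ballI impI)
    fix z assume z: "\<not> is_pole f z"
    have "(norm (f z - a))\<^sup>2 \<le> (norm (f z) + norm a)\<^sup>2"
      by (intro power_mono norm_triangle_ineq4) simp
    also have "\<dots> \<le> 2 * (norm (f z))\<^sup>2 + 2 * (norm a)\<^sup>2"
      using zero_le_power2[of "norm (f z) - norm a"] by (simp add: power2_eq_square algebra_simps)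
    finally have "(norm (f z - a))\<^sup>2 \<le> 2 * (norm (f z))\<^sup>2 + 2 * (norm a)\<^sup>2" .
    moreover have "(2 + 2 * (norm a)\<^sup>2) * (1 + (norm (f z))\<^sup>2) =
        2 + 2 * (norm (f z))\<^sup>2 + 2 * (norm a)\<^sup>2 + 2 * ((norm a)\<^sup>2 * (norm (f z))\<^sup>2)"
      by (simp add: algebra_simps)
    moreover have "0 \<le> (norm a)\<^sup>2 * (norm (f z))\<^sup>2" by simp
    ultimately have "1 + (norm (f z - a))\<^sup>2 \<le> (2 + 2 * (norm a)\<^sup>2) * (1 + (norm (f z))\<^sup>2)"
      by linarith
    then have "\<bar>C\<bar> * (1 + (norm (f z - a))\<^sup>2) \<le> \<bar>C\<bar> * ((2 + 2 * (norm a)\<^sup>2) * (1 + (norm (f z))\<^sup>2))"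
      by (rule mult_left_mono) simp
    moreover have "C * (1 + (norm (f z - a))\<^sup>2) \<le> \<bar>C\<bar> * (1 + (norm (f z - a))\<^sup>2)"
      by (rule mult_right_mono) auto
    moreover have "norm (deriv f z) \<le> C * (1 + (norm (f z - a))\<^sup>2)"
    proof -
      have "norm (deriv F z) \<le> C * (1 + (norm (F z))\<^sup>2)"
        using C z pole by (simp add: sph_deriv_le_def)
      then show ?thesis by (simp only: val[OF z] der[OF z])
    qed
    ultimately show "norm (deriv f z) \<le> \<bar>C\<bar> * (2 + 2 * (norm a)\<^sup>2) * (1 + (norm (f z))\<^sup>2)"
      by (simp add: mult.assoc)
  qed
  then show ?thesis by (rule normal_function_if_bounded_spherical_deriv[OF f])
qed

end
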